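(* Let $K=\mathbb{Q}(\iota)((s))((r))$ with $\iota=\sqrt{-1}$, let $F=K(y)$ with $y^{4}=s$, and let $\sigma$ be the $K$-automorphism of $F$ with $\sigma(y)=\iota y$. Then the element $$A=(1+y^{2})x^{-2}+\frac{r}{2}\,y^{2}$$ has reduced trace zero in the degree-four central division algebra $D=F((x;\sigma))$, but $A$ is not a single commutator in $D$; that is, there are no $B,C\in D$ with $A=BC-CB$.
   Context: $\mathbb{Q}(\iota)((s))$ is the field of formal Laurent series in $s$ over $\mathbb{Q}(\iota)$, and $K=\mathbb{Q}(\iota)((s))((r))$ is the field of formal Laurent series in $r$ over it. The polynomial $Y^4-s$ is irreducible over $K$, so $F=K(y)$ is a cyclic Galois extension of $K$ of degree $4$ with $\operatorname{Gal}(F/K)=\langle\sigma\rangle$. The skew Laurent series ring $D=F((x;\sigma))$ consists of formal series $\sum_{m\ge m_0}a_mx^m$ with $a_m\in F$, $m_0\in\mathbb{Z}$, with multiplication determined by $xa=\sigma(a)x$ for $a\in F$, i.e. $(ax^i)(bx^j)=a\sigma^i(b)x^{i+j}$. It is a division ring with center $Z(D)=K((x^4))$ and is of dimension $16$ over its center, i.e. a central division algebra of degree $4$ over $Z(D)$. "Reduced trace" means the reduced trace $\operatorname{Trd}_{D/Z(D)}$ of this central simple algebra; explicitly, $\operatorname{Trd}_{D/Z(D)}\bigl(\sum_m a_mx^m\bigr)=\sum_{m\equiv 0 \pmod 4}\operatorname{Tr}_{F/K}(a_m)x^m$. *)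

theory Defs
  imports
    Complex_Main
    "HOL-Computational_Algebra.Formal_Laurent_Series"
    "HOL-Algebra.Algebra"
    "HOL-Algebra.Algebraic_Closure_Type"
begin

section \<open>The field \<open>\<rat>(\<iota>)((s))((r))\<close>\<close>

typedef gaussian_rat = "{z :: complex. Re z \<in> \<rat> \<and> Im z \<in> \<rat>}"
  by (rule exI[of _ 0]) simp

setup_lifting type_definition_gaussian_rat

instantiation gaussian_rat :: field
begin

lift_definition zero_gaussian_rat :: gaussian_rat is 0 by simp
lift_definition one_gaussian_rat :: gaussian_rat is 1 by simp
lift_definition plus_gaussian_rat :: "gaussian_rat \<Rightarrow> gaussian_rat \<Rightarrow> gaussian_rat"
  is "(+)" by simp
lift_definition minus_gaussian_rat :: "gaussian_rat \<Rightarrow> gaussian_rat \<Rightarrow> gaussian_rat"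
  is "(-)" by simp
lift_definition uminus_gaussian_rat :: "gaussian_rat \<Rightarrow> gaussian_rat"
  is uminus by simp
lift_definition times_gaussian_rat :: "gaussian_rat \<Rightarrow> gaussian_rat \<Rightarrow> gaussian_rat"
  is "(*)" by simp
lift_definition inverse_gaussian_rat :: "gaussian_rat \<Rightarrow> gaussian_rat"
  is inverse by simp
lift_definition divide_gaussian_rat :: "gaussian_rat \<Rightarrow> gaussian_rat \<Rightarrow> gaussian_rat"
  is "(/)" by (simp add: Re_divide Im_divide)

instance
  by standard (transfer; simp add: algebra_simps divide_inverse)+

end

lift_definition gaussian_i :: gaussian_rat is \<i> by simp

type_synonym K_field = "gaussian_rat fls fls"

definition K_iota :: K_field where "K_iota = fls_const (fls_const gaussian_i)"
definition K_s :: K_field where "K_s = fls_const fls_X"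
definition K_r :: K_field where "K_r = fls_X"


section \<open>Skew Laurent series\<close>

definition int_funpow :: "('a \<Rightarrow> 'a) \<Rightarrow> int \<Rightarrow> 'a \<Rightarrow> 'a" where
  "int_funpow f m = (if m \<ge> 0 then f ^^ nat m else (the_inv f) ^^ nat (- m))"

text \<open>
  A skew Laurent series is represented by its coefficient sequence, for which the type of
  (commutative) formal Laurent series is reused. Only the additive structure of that type is
  meaningful here; its commutative multiplication is not the multiplication of \<open>F((x;\<sigma>))\<close>.
\<close>

definition skew_mult :: "('f :: field \<Rightarrow> 'f) \<Rightarrow> 'f fls \<Rightarrow> 'f fls \<Rightarrow> 'f fls" where
  "skew_mult \<sigma> B C = Abs_fls (\<lambda>n. \<Sum>i = fls_subdegree B..n - fls_subdegree C.
     fls_nth B i * int_funpow \<sigma> i (fls_nth C (n - i)))"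

definition skew_monom :: "'f :: field \<Rightarrow> int \<Rightarrow> 'f fls" where
  "skew_monom a m = fls_shift (- m) (fls_const a)"

definition skew_laurent :: "('f :: field \<Rightarrow> 'f) \<Rightarrow> 'f fls ring" where
  "skew_laurent \<sigma> = \<lparr>carrier = UNIV, monoid.mult = skew_mult \<sigma>, one = skew_monom 1 0,
     ring.zero = 0, add = (+)\<rparr>"

lemma fls_nth_skew_mult:
  "fls_nth (skew_mult \<sigma> B C) n = (\<Sum>i = fls_subdegree B..n - fls_subdegree C.
     fls_nth B i * int_funpow \<sigma> i (fls_nth C (n - i)))"
  unfolding skew_mult_def
  by (rule nth_Abs_fls_lower_bound[of "fls_subdegree B + fls_subdegree C"]) auto

lemma fls_nth_skew_monom: "fls_nth (skew_monom a m) n = (if n = m then a else 0)"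
  by (simp add: skew_monom_def)

lemma skew_mult_monom:
  assumes "bij \<sigma>" "\<sigma> 0 = 0"
  shows "skew_mult \<sigma> (skew_monom a i) (skew_monom b j) =
    skew_monom (a * int_funpow \<sigma> i b) (i + j)"
proof -
  have inv0: "the_inv \<sigma> 0 = 0"
    using assms the_inv_f_f[of \<sigma> 0] by (simp add: bij_is_inj)
  have "(\<sigma> ^^ k) 0 = 0" "(the_inv \<sigma> ^^ k) 0 = 0" for k
    by (induction k) (simp_all add: assms inv0)
  then have p0: "int_funpow \<sigma> m 0 = 0" for m
    by (simp add: int_funpow_def)
  have sd: "fls_subdegree (skew_monom c m) = m" if "c \<noteq> 0" for c :: 'a and m
    using that by (simp add: skew_monom_def)
  have z: "skew_monom 0 m = (0 :: 'a fls)" for m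
    by (rule fls_eqI) (simp add: fls_nth_skew_monom)
  show ?thesis
  proof (cases "a = 0 \<or> b = 0")
    case True
    then show ?thesis
      by (auto intro!: fls_eqI simp: fls_nth_skew_mult fls_nth_skew_monom z p0)
  next
    case False
    have "(\<Sum>k = i..n - j. fls_nth (skew_monom a i) k *
        int_funpow \<sigma> k (fls_nth (skew_monom b j) (n - k))) =
      (\<Sum>k \<in> {i..n - j}. if k = i then (if n = i + j then a * int_funpow \<sigma> i b else 0) else 0)"
      for n
      by (rule sum.cong) (auto simp: fls_nth_skew_monom p0)
    then show ?thesis
      using False by (auto intro!: fls_eqI simp: fls_nth_skew_mult sd fls_nth_skew_monom)
  qed
qed


section \<open>The reduced trace\<close>

definition ring_center :: "('a, 'm) ring_scheme \<Rightarrow> 'a set" where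
  "ring_center D = {z \<in> carrier D. \<forall>a \<in> carrier D. z \<otimes>\<^bsub>D\<^esub> a = a \<otimes>\<^bsub>D\<^esub> z}"

definition scalar_matrix :: "('a, 'm) ring_scheme \<Rightarrow> nat \<Rightarrow> 'a \<Rightarrow> nat \<times> nat \<Rightarrow> 'a" where
  "scalar_matrix L n c = (\<lambda>(i, j) \<in> {..<n} \<times> {..<n}. if i = j then c else \<zero>\<^bsub>L\<^esub>)"

definition matrix_ring :: "('a, 'm) ring_scheme \<Rightarrow> nat \<Rightarrow> (nat \<times> nat \<Rightarrow> 'a) ring" where
  "matrix_ring L n = \<lparr>
     carrier = {..<n} \<times> {..<n} \<rightarrow>\<^sub>E carrier L,
     monoid.mult = (\<lambda>M N. \<lambda>(i, j) \<in> {..<n} \<times> {..<n}.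
       \<Oplus>\<^bsub>L\<^esub>k \<in> {..<n}. M (i, k) \<otimes>\<^bsub>L\<^esub> N (k, j)),
     one = scalar_matrix L n \<one>\<^bsub>L\<^esub>,
     ring.zero = scalar_matrix L n \<zero>\<^bsub>L\<^esub>,
     add = (\<lambda>M N. \<lambda>p \<in> {..<n} \<times> {..<n}. M p \<oplus>\<^bsub>L\<^esub> N p)\<rparr>"

definition matrix_trace :: "('a, 'm) ring_scheme \<Rightarrow> nat \<Rightarrow> (nat \<times> nat \<Rightarrow> 'a) \<Rightarrow> 'a" where
  "matrix_trace L n M = (\<Oplus>\<^bsub>L\<^esub>i \<in> {..<n}. M (i, i))"

text \<open>
  Let \<open>D\<close> be a central simple algebra over its center \<open>Z\<close>. A splitting of degree \<open>n\<close> is an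
  extension field \<open>L\<close> of \<open>Z\<close> with an isomorphism \<open>D \<otimes>\<^sub>Z L \<cong> M\<^sub>n(L)\<close> of
  \<open>L\<close>-algebras, given here by its restriction \<open>\<phi>\<close> to \<open>D\<close>. The induced map
  \<open>D \<otimes>\<^sub>Z L \<rightarrow> M\<^sub>n(L)\<close> is surjective iff the \<open>L\<close>-span of \<open>\<phi>(D)\<close> is \<open>M\<^sub>n(L)\<close>, and it is always
  injective since \<open>D \<otimes>\<^sub>Z L\<close> is simple and \<open>n > 0\<close>. It suffices to let \<open>L\<close> range
  over the subfields of \<open>D\<close> containing \<open>Z\<close>: the maximal subfields of a division algebra split it.
\<close>

definition splitting ::
  "('a, 'm) ring_scheme \<Rightarrow> 'a set \<Rightarrow> nat \<Rightarrow> ('a \<Rightarrow> nat \<times> nat \<Rightarrow> 'a) \<Rightarrow> bool" where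
  "splitting D L n \<phi> \<longleftrightarrow>
     subfield L D \<and> ring_center D \<subseteq> L \<and> n > 0 \<and>
     (let L' = D\<lparr>carrier := L\<rparr>; M = matrix_ring L' n in
       \<phi> \<in> ring_hom D M \<and>
       (\<forall>z \<in> ring_center D. \<phi> z = scalar_matrix L' n z) \<and>
       (\<forall>N \<in> carrier M. \<exists>k. \<exists>d \<in> {..<k::nat} \<rightarrow> carrier D. \<exists>c \<in> {..<k} \<rightarrow> L.
         N = (\<Oplus>\<^bsub>M\<^esub>i \<in> {..<k}. scalar_matrix L' n (c i) \<otimes>\<^bsub>M\<^esub> \<phi> (d i))))"

text \<open>The trace of \<open>\<phi>(a)\<close> lies in the center and is the same for every splitting.\<close>

definition reduced_trace :: "('a, 'm) ring_scheme \<Rightarrow> 'a \<Rightarrow> 'a" where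
  "reduced_trace D a = (THE t. \<exists>L n \<phi>. splitting D L n \<phi> \<and>
     t = matrix_trace (D\<lparr>carrier := L\<rparr>) n (\<phi> a))"

end

theory Submission
  imports Defs
begin

text \<open>
  The proof works in the skew Laurent series ring \<open>D\<close> through coefficients: an element of \<open>D\<close>
  is \<open>b = \<Sum>\<^sub>m b\<^sub>m x\<^sup>m\<close>, and each \<open>b\<^sub>m \<in> F\<close> has four coordinates \<open>co k b\<^sub>m \<in> K\<close> with respect to \<open>1,
  y, y\<^sup>2, y\<^sup>3\<close>.

  \<^emph>\<open>The reduced trace.\<close> Each of the two terms of \<open>A\<close> is a commutator, so \<open>A\<close> is a sum of two
  commutators and the matrix trace of \<open>\<phi> A\<close> vanishes for every splitting \<open>\<phi>\<close>
  (\<open>splitting_trace_sum_of_commutators\<close>). To conclude that the reduced trace is zero it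
  remains to exhibit one splitting: \<open>D\<close> acts from the left on itself, viewed as a right vector
  space with basis \<open>1, y, y\<^sup>2, y\<^sup>3\<close> over the maximal subfield \<open>K((x))\<close> (\<open>splitting_rep\<close>).

  \<^emph>\<open>No single commutator.\<close> Suppose \<open>A = BC - CB\<close>. If \<open>b\<close> commutes with \<open>B\<close>, then \<open>Ab = B(Cb) -
  (Cb)B\<close> has reduced trace zero, which means for all \<open>n\<close> divisible by 4 that \<open>co 0 b\<^bsub>n+2\<^esub> + s \<cdot>
  co 2 b\<^bsub>n+2\<^esub> + (r s / 2) \<cdot> co 2 b\<^sub>n = 0\<close> (\<open>orthogonal_centralizer\<close>). Let \<open>b \<noteq> 0\<close> have order \<open>m\<close>
  in \<open>x\<close> and leading coefficient \<open>b\<^sub>m\<close>. If \<open>m\<close> is odd, or if \<open>m\<close> is even and \<open>b\<^sub>m \<in> K y + K y\<^sup>3\<close>,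
  the condition for \<open>b\<^sup>2\<close> at \<open>n = 2 m - 2\<close>, respectively \<open>n = 2 m\<close>, is a nontrivial zero over
  \<open>K\<close> of a form \<open>b0\<^sup>2 - s b2\<^sup>2 \<plusminus> \<iota> s (b1\<^sup>2 - s b3\<^sup>2) \<plusminus> (r s / 2) (u\<^sup>2 + s v\<^sup>2)\<close>. Such a form is
  anisotropic: splitting off first \<open>r\<close> and then \<open>s\<close> by Springer's theorem on quadratic forms
  over Laurent series (\<open>anisotropic_fls\<close>) leaves forms over \<open>\<rat>(\<iota>)\<close> in at most two variables,
  and \<open>\<plusminus>\<iota>\<close> is not a square there. So every nonzero element of the centralizer of \<open>B\<close> has even
  order (\<open>centralizer_even_order\<close>) and a leading coefficient outside \<open>K y + K y\<^sup>3\<close>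
  (\<open>centralizer_lead_nonzero\<close>).

  These two facts are contradicted as follows. If \<open>B\<close> is quadratic over the center, completing
  the square gives an element \<open>u\<close> of the centralizer that anticommutes with \<open>A\<close>, and comparing
  leading terms puts its leading coefficient in \<open>K y + K y\<^sup>3\<close> (\<open>not_quadratic\<close>). Otherwise \<open>1,
  B, B\<^sup>2\<close> are independent over the center, so that two prescribed coordinates can be eliminated
  from their span (\<open>double_centralizer_elimination\<close>). This yields commuting elements \<open>b\<close> of
  order 0 and \<open>c\<close> of order 2 modulo 4; commutation forces the leading coefficient of \<open>b\<close> into
  \<open>K y\<^sup>2\<close>, and the conditions for \<open>c\<close> and \<open>bc\<close> then put that of \<open>c\<close> into \<open>K y + K y\<^sup>3\<close>.
\<close>

notation fls_nth (infixl "$$" 75)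

section \<open>Skew Laurent series over a field with an automorphism\<close>

lemma int_funpow_0: "int_funpow f 0 = id"
  by (simp add: int_funpow_def fun_eq_iff)

lemma int_funpow_1: "int_funpow f 1 = f"
  by (simp add: int_funpow_def fun_eq_iff)

lemma int_funpow_Suc:
  assumes "bij f"
  shows "int_funpow f (i + 1) a = f (int_funpow f i a)"
proof (cases "i \<ge> 0")
  case True
  then have "nat (i + 1) = Suc (nat i)" by simp
  then show ?thesis using True by (simp add: int_funpow_def)
next
  case False
  define k where "k = nat (- i - 1)"
  have k: "nat (- i) = Suc k" "i = - int k - 1" using False by (auto simp: k_def)
  have "f (the_inv f b) = b" for b
    using assms by (simp add: bij_def f_the_inv_into_f)
  moreover have "nat (int l + 1) = Suc l" for l
    by simp
  ultimately show ?thesis using False k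
    by (cases k) (auto simp: int_funpow_def)
qed

lemma int_funpow_add:
  assumes "bij f"
  shows "int_funpow f (i + j) a = int_funpow f i (int_funpow f j a)"
proof (induction i rule: int_induct[of _ 0])
  case base
  show ?case by (simp add: int_funpow_0)
next
  case (step1 i)
  have "int_funpow f (i + 1 + j) a = f (int_funpow f (i + j) a)"
    using int_funpow_Suc[OF assms, of "i + j" a] by (simp add: algebra_simps)
  then show ?case using step1 by (simp add: int_funpow_Suc[OF assms])
next
  case (step2 i)
  have "f (int_funpow f (i - 1 + j) a) = int_funpow f (i + j) a"
    using int_funpow_Suc[OF assms, of "i - 1 + j" a] by (simp add: algebra_simps)
  also have "\<dots> = f (int_funpow f (i - 1) (int_funpow f j a))"
    using step2 int_funpow_Suc[OF assms, of "i - 1"] by simp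
  finally show ?case using assms by (simp add: bij_def inj_eq)
qed

locale field_automorphism =
  fixes \<sigma> :: "'f :: field \<Rightarrow> 'f"
  assumes bij: "bij \<sigma>"
    and add: "\<sigma> (a + b) = \<sigma> a + \<sigma> b"
    and mult: "\<sigma> (a * b) = \<sigma> a * \<sigma> b"
begin

abbreviation pw :: "int \<Rightarrow> 'f \<Rightarrow> 'f" where "pw \<equiv> int_funpow \<sigma>"

abbreviation skew_times :: "'f fls \<Rightarrow> 'f fls \<Rightarrow> 'f fls" (infixl "\<star>" 70)
  where "skew_times \<equiv> skew_mult \<sigma>"

lemma zero: "\<sigma> 0 = 0"
  using add[of 0 0] by (metis add.right_neutral add_left_cancel)

lemma eq_0_iff: "\<sigma> a = 0 \<longleftrightarrow> a = 0"
  using bij zero by (metis bij_pointE)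

lemma one: "\<sigma> 1 = 1"
  using mult[of 1 1] eq_0_iff[of 1] by simp

lemma minus: "\<sigma> (- a) = - \<sigma> a"
  using add[of a "- a"] zero by (simp add: add_eq_0_iff)

text \<open>
  A property of maps that holds for the identity and is preserved by composition with \<open>\<sigma>\<close> and
  its inverse holds for every power of \<open>\<sigma>\<close>; this transports the homomorphism laws to \<open>pw i\<close>.
\<close>
lemma pw_induct:
  assumes "P id" "\<And>g. P g \<Longrightarrow> P (\<lambda>a. \<sigma> (g a))" "\<And>g. P g \<Longrightarrow> P (\<lambda>a. the_inv \<sigma> (g a))"
  shows "P (pw i)"
proof -
  have "P (\<sigma> ^^ n)" "P (the_inv \<sigma> ^^ n)" for n
    using assms by (induction n) (auto simp: id_def comp_def)
  then show ?thesis by (auto simp: int_funpow_def fun_eq_iff)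
qed

lemma inv_\<sigma>: "the_inv \<sigma> (\<sigma> a) = a" "\<sigma> (the_inv \<sigma> a) = a"
  using bij by (simp_all add: bij_def the_inv_f_f f_the_inv_into_f)

lemma pw_add: "pw i (a + b) = pw i a + pw i b"
proof -
  have "the_inv \<sigma> (a + b) = the_inv \<sigma> a + the_inv \<sigma> b" for a b
    by (metis add inv_\<sigma>)
  then have "\<forall>a b. pw i (a + b) = pw i a + pw i b"
    by (intro pw_induct[where P = "\<lambda>g. \<forall>a b. g (a + b) = g a + g b" and i = i]) (simp_all add: add)
  then show ?thesis by blast
qed

lemma pw_mult: "pw i (a * b) = pw i a * pw i b"
proof -
  have "the_inv \<sigma> (a * b) = the_inv \<sigma> a * the_inv \<sigma> b" for a b
    by (metis mult inv_\<sigma>)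
  then have "\<forall>a b. pw i (a * b) = pw i a * pw i b"
    by (intro pw_induct[where P = "\<lambda>g. \<forall>a b. g (a * b) = g a * g b" and i = i]) (simp_all add: mult)
  then show ?thesis by blast
qed

lemma pw_pw: "pw i (pw j a) = pw (i + j) a"
  by (simp add: int_funpow_add[OF bij])

lemma pw_id [simp]: "pw 0 a = a"
  by (simp add: int_funpow_0)

lemma pw_zero [simp]: "pw i 0 = 0"
  using pw_add[of i 0 0] by (metis add.right_neutral add_left_cancel)

lemma pw_eq_0_iff [simp]: "pw i a = 0 \<longleftrightarrow> a = 0"
  using pw_pw[of "- i" i a] by auto

lemma pw_one [simp]: "pw i 1 = 1"
  using pw_mult[of i 1 1] by simp

lemma pw_sum: "pw i (sum g I) = (\<Sum>k\<in>I. pw i (g k))"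
  by (induction I rule: infinite_finite_induct) (auto simp: pw_add)

lemma pw_power: "pw i (a ^ n) = pw i a ^ n"
  by (induction n) (auto simp: pw_mult)

text \<open>
  The defining sum runs over an interval given by the subdegrees. Any finite index set outside
  of which the summands vanish gives the same value, so that sums for different factors can be
  compared term by term.
\<close>
lemma nth_skew_mult:
  assumes "finite I" "\<And>i. i \<notin> I \<Longrightarrow> B $$ i = 0 \<or> C $$ (n - i) = 0"
  shows "(B \<star> C) $$ n = (\<Sum>i\<in>I. B $$ i * pw i (C $$ (n - i)))"
proof -
  let ?J = "{fls_subdegree B..n - fls_subdegree C}"
  have J: "B $$ i = 0 \<or> C $$ (n - i) = 0" if "i \<notin> ?J" for i
    using that by auto
  have "(\<Sum>i\<in>?J. B $$ i * pw i (C $$ (n - i))) = (\<Sum>i\<in>?J \<union> I. B $$ i * pw i (C $$ (n - i)))"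
    by (rule sum.mono_neutral_left) (use assms J in force)+
  also have "\<dots> = (\<Sum>i\<in>I. B $$ i * pw i (C $$ (n - i)))"
    by (rule sum.mono_neutral_right) (use assms in force)+
  finally show ?thesis by (simp add: fls_nth_skew_mult)
qed

lemma nth_skew_mult_eq_0:
  assumes "\<And>i. i < p \<Longrightarrow> B $$ i = 0" "\<And>i. i < q \<Longrightarrow> C $$ i = 0" "n < p + q"
  shows "(B \<star> C) $$ n = 0"
  using assms by (subst nth_skew_mult[of "{}"]) force+

lemma nth_skew_mult_lead:
  assumes "\<And>i. i < p \<Longrightarrow> B $$ i = 0" "\<And>i. i < q \<Longrightarrow> C $$ i = 0"
  shows "(B \<star> C) $$ (p + q) = B $$ p * pw p (C $$ q)"
proof -
  have "(B \<star> C) $$ (p + q) = (\<Sum>i\<in>{p}. B $$ i * pw i (C $$ (p + q - i)))"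
  proof (rule nth_skew_mult)
    show "B $$ i = 0 \<or> C $$ (p + q - i) = 0" if "i \<notin> {p}" for i
      using that assms(1)[of i] assms(2)[of "p + q - i"] by (cases "i < p") auto
  qed simp
  then show ?thesis by simp
qed

lemma nth_monom_mult: "(skew_monom a m \<star> C) $$ n = a * pw m (C $$ (n - m))"
  by (subst nth_skew_mult[of "{m}"]) (auto simp: fls_nth_skew_monom)

lemma nth_mult_monom: "(C \<star> skew_monom a m) $$ n = C $$ (n - m) * pw (n - m) a"
  by (subst nth_skew_mult[of "{n - m}"]) (auto simp: fls_nth_skew_monom)

lemma skew_distrib_left: "B \<star> (C + D) = B \<star> C + B \<star> D"
proof (rule fls_eqI)
  fix n
  let ?I = "{fls_subdegree B..n - min (fls_subdegree C) (fls_subdegree D)}"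
  have "(B \<star> E) $$ n = (\<Sum>i\<in>?I. B $$ i * pw i (E $$ (n - i)))" if "E = C \<or> E = D \<or> E = C + D" for E
    by (rule nth_skew_mult) (use that in auto)
  then show "(B \<star> (C + D)) $$ n = (B \<star> C + B \<star> D) $$ n"
    by (simp add: pw_add sum.distrib distrib_left)
qed

lemma skew_distrib_right: "(C + D) \<star> B = C \<star> B + D \<star> B"
proof (rule fls_eqI)
  fix n
  let ?I = "{min (fls_subdegree C) (fls_subdegree D)..n - fls_subdegree B}"
  have "(E \<star> B) $$ n = (\<Sum>i\<in>?I. E $$ i * pw i (B $$ (n - i)))" if "E = C \<or> E = D \<or> E = C + D" for E
    by (rule nth_skew_mult) (use that in auto)
  then show "((C + D) \<star> B) $$ n = (C \<star> B + D \<star> B) $$ n"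
    by (simp add: sum.distrib distrib_right)
qed

lemma skew_zero [simp]: "0 \<star> B = 0" "B \<star> 0 = 0"
  using skew_distrib_right[of 0 0 B] skew_distrib_left[of B 0 0]
  by (metis add.right_neutral add_left_cancel)+

lemma skew_minus: "(- C) \<star> B = - (C \<star> B)" "B \<star> (- C) = - (B \<star> C)"
  using skew_distrib_right[of C "- C" B] skew_distrib_left[of B C "- C"]
  by (simp_all add: add_eq_0_iff)

lemma skew_diff: "(C - D) \<star> B = C \<star> B - D \<star> B" "B \<star> (C - D) = B \<star> C - B \<star> D"
  using skew_distrib_right[of C "- D" B] skew_distrib_left[of B C "- D"]
  by (simp_all add: skew_minus)

lemma skew_sum: "sum g I \<star> B = (\<Sum>i\<in>I. g i \<star> B)" "B \<star> sum g I = (\<Sum>i\<in>I. B \<star> g i)"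
  by (induction I rule: infinite_finite_induct) (auto simp: skew_distrib_left skew_distrib_right)

lemma skew_one [simp]: "skew_monom 1 0 \<star> B = B" "B \<star> skew_monom 1 0 = B"
  by (auto intro!: fls_eqI simp: nth_monom_mult nth_mult_monom)

text \<open>
  Both sides are sums of \<open>B\<^sub>i \<sigma>\<^sup>i(C\<^sub>j) \<sigma>\<^bsup>i+j\<^esup>(D\<^sub>l)\<close> over \<open>i + j + l = n\<close>; a common lower bound \<open>p\<close>
  of the three orders makes all index sets finite and independent of the inner index.
\<close>
lemma skew_assoc: "(B \<star> C) \<star> D = B \<star> (C \<star> D)"
proof (rule fls_eqI)
  fix n
  define p where "p = min (fls_subdegree B) (min (fls_subdegree C) (fls_subdegree D))"
  have low: "B $$ i = 0" "C $$ i = 0" "D $$ i = 0" if "i < p" for i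
    using that by (auto simp: p_def)
  define I where "I = {2 * p..n - p}"
  define J where "J = {p..n - 2 * p}"
  have "((B \<star> C) \<star> D) $$ n = (\<Sum>k\<in>I. (B \<star> C) $$ k * pw k (D $$ (n - k)))"
    by (rule nth_skew_mult) (auto simp: I_def not_le intro: low nth_skew_mult_eq_0[of p B p C])
  also have "\<dots> = (\<Sum>k\<in>I. (\<Sum>i\<in>J. B $$ i * pw i (C $$ (k - i))) * pw k (D $$ (n - k)))"
    by (intro sum.cong arg_cong2[of _ _ _ _ "(*)"] nth_skew_mult refl)
      (auto simp: I_def J_def not_le intro: low)
  also have "\<dots> = (\<Sum>i\<in>J. \<Sum>k\<in>I. B $$ i * (pw i (C $$ (k - i)) * pw k (D $$ (n - k))))"
    by (subst sum.swap) (simp add: sum_distrib_right mult.assoc)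
  also have "\<dots> = (\<Sum>i\<in>J. B $$ i * pw i ((C \<star> D) $$ (n - i)))"
  proof (rule sum.cong[OF refl])
    fix i assume i: "i \<in> J"
    have "(C \<star> D) $$ (n - i) = (\<Sum>j\<in>{2 * p - i..n - p - i}. C $$ j * pw j (D $$ (n - i - j)))"
      using i by (intro nth_skew_mult) (auto simp: J_def not_le intro: low)
    also have "\<dots> = (\<Sum>k\<in>I. C $$ (k - i) * pw (k - i) (D $$ (n - k)))"
      by (rule sum.reindex_bij_witness[of _ "\<lambda>k. k - i" "\<lambda>j. j + i"])
        (auto simp: I_def algebra_simps)
    finally show "(\<Sum>k\<in>I. B $$ i * (pw i (C $$ (k - i)) * pw k (D $$ (n - k)))) =
        B $$ i * pw i ((C \<star> D) $$ (n - i))"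
      by (simp add: pw_sum pw_mult pw_pw sum_distrib_left)
  qed
  also have "\<dots> = (B \<star> (C \<star> D)) $$ n"
    by (rule nth_skew_mult[symmetric])
      (auto simp: J_def not_le intro: low nth_skew_mult_eq_0[of p C p D])
  finally show "((B \<star> C) \<star> D) $$ n = (B \<star> (C \<star> D)) $$ n" .
qed

text \<open>
  The leading coefficients multiply to a nonzero element of the field.
\<close>
lemma skew_mult_eq_0_iff: "B \<star> C = 0 \<longleftrightarrow> B = 0 \<or> C = 0"
proof
  assume BC: "B \<star> C = 0"
  show "B = 0 \<or> C = 0"
  proof (rule ccontr)
    assume "\<not> (B = 0 \<or> C = 0)"
    then have "B $$ fls_subdegree B \<noteq> 0" "C $$ fls_subdegree C \<noteq> 0"
      by auto
    moreover have "(B \<star> C) $$ (fls_subdegree B + fls_subdegree C) =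
        B $$ fls_subdegree B * pw (fls_subdegree B) (C $$ fls_subdegree C)"
      by (rule nth_skew_mult_lead) auto
    ultimately show False using BC by simp
  qed
qed auto

lemma ring_skew_laurent: "ring (skew_laurent \<sigma>)"
proof (rule ringI)
  show "abelian_group (skew_laurent \<sigma>)"
  proof (rule abelian_groupI)
    show "\<exists>y\<in>carrier (skew_laurent \<sigma>). y \<oplus>\<^bsub>skew_laurent \<sigma>\<^esub> x = \<zero>\<^bsub>skew_laurent \<sigma>\<^esub>" for x
      by (rule bexI[of _ "- x"]) (auto simp: skew_laurent_def)
  qed (auto simp: skew_laurent_def)
  show "Group.monoid (skew_laurent \<sigma>)"
    by (rule monoidI) (auto simp: skew_laurent_def skew_assoc)
qed (auto simp: skew_laurent_def skew_distrib_left skew_distrib_right)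

lemma skew_laurent_minus: "B \<ominus>\<^bsub>skew_laurent \<sigma>\<^esub> C = B - C"
proof -
  interpret R: ring "skew_laurent \<sigma>" by (rule ring_skew_laurent)
  have "\<ominus>\<^bsub>skew_laurent \<sigma>\<^esub> C = - C"
    by (rule R.minus_equality) (auto simp: skew_laurent_def)
  then show ?thesis by (simp add: a_minus_def) (simp add: skew_laurent_def)
qed

end

section \<open>Anisotropic diagonal forms\<close>

definition anisotropic :: "'k :: field list \<Rightarrow> bool" where
  "anisotropic as \<longleftrightarrow> (\<forall>x. (\<Sum>i<length as. as ! i * x i ^ 2) = 0 \<longrightarrow> (\<forall>i<length as. x i = 0))"

lemma fls_square_nth:
  fixes f :: "'k :: comm_ring_1 fls"
  assumes "\<And>i. i < m \<Longrightarrow> f $$ i = 0"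
  shows "(f ^ 2) $$ (2 * m) = (f $$ m) ^ 2" "n < 2 * m \<Longrightarrow> (f ^ 2) $$ n = 0"
    "f $$ m = 0 \<Longrightarrow> n < 2 * m + 2 \<Longrightarrow> (f ^ 2) $$ n = 0"
proof -
  have sub: "n \<le> fls_subdegree f \<or> f = 0" if "\<And>i. i < n \<Longrightarrow> f $$ i = 0" for n
    using that by (metis fls_subdegree_geI)
  have z: "(f ^ 2) $$ n = 0" if "\<And>i. i < k \<Longrightarrow> f $$ i = 0" "n < 2 * k" for n k
    using sub[of k] that by (auto simp: power2_eq_square intro: fls_times_nth_eq0)
  show "n < 2 * m \<Longrightarrow> (f ^ 2) $$ n = 0" by (rule z[OF assms])
  show "(f ^ 2) $$ n = 0" if "f $$ m = 0" "n < 2 * m + 2"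
    using assms that by (intro z[of "m + 1"]) (auto simp: order.order_iff_strict zless_add1_eq)
  show "(f ^ 2) $$ (2 * m) = (f $$ m) ^ 2"
  proof (cases "f $$ m = 0")
    case True
    then have "f $$ i = 0" if "i < m + 1" for i
      using that assms by (cases "i = m") auto
    then show ?thesis using z[of "m + 1" "2 * m"] True by auto
  next
    case False
    then have "fls_subdegree f = m" using assms by (intro fls_subdegree_eqI) auto
    then show ?thesis by (metis fls_times_base mult_2 power2_eq_square)
  qed
qed

lemma sum_lessThan_add:
  fixes g :: "nat \<Rightarrow> 'a :: comm_monoid_add"
  shows "(\<Sum>i<m + n. g i) = (\<Sum>i<m. g i) + (\<Sum>i<n. g (i + m))"
  by (induction n) (simp_all add: ac_simps)

text \<open>
  The easy direction of Springer's theorem: the terms with constant coefficients have even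
  order, those with coefficients in \<open>fls_X\<close> times constants odd order, so that the lowest
  terms of the two blocks cannot cancel each other and are governed by the two forms over the
  residue field.
\<close>
lemma anisotropic_fls:
  fixes as cs :: "'k :: field list"
  assumes "anisotropic as" "anisotropic cs"
  shows "anisotropic (map fls_const as @ map (\<lambda>c. fls_X * fls_const c) cs)"
  unfolding anisotropic_def
proof (intro allI impI)
  fix x :: "nat \<Rightarrow> 'k fls" and i
  let ?q = "length as" and ?l = "length cs"
  assume eq: "(\<Sum>i<length (map fls_const as @ map (\<lambda>c. fls_X * fls_const c) cs).
      (map fls_const as @ map (\<lambda>c. fls_X * fls_const c) cs) ! i * x i ^ 2) = 0"
    and i: "i < length (map fls_const as @ map (\<lambda>c. fls_X * fls_const c) cs)"
  have "(\<Sum>i<?q + ?l. (map fls_const as @ map (\<lambda>c. fls_X * fls_const c) cs) ! i * x i ^ 2) =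
    (\<Sum>i<?q. fls_const (as ! i) * x i ^ 2) + (\<Sum>i<?l. fls_X * fls_const (cs ! i) * x (i + ?q) ^ 2)"
    by (simp add: sum_lessThan_add nth_append)
  then have eq': "(\<Sum>i<?q. fls_const (as ! i) * x i ^ 2) +
      (\<Sum>i<?l. fls_X * fls_const (cs ! i) * x (i + ?q) ^ 2) = 0"
    using eq by simp
  have nthX: "(fls_X * fls_const c * f) $$ n = c * f $$ (n - 1)" for c n and f :: "'k fls"
    by (simp add: mult.assoc fls_X_times_conv_shift(1)[of "fls_const c * f"] del: fls_X_times_conv_shift)
  have eqn: "(\<Sum>i<?q. as ! i * (x i ^ 2) $$ n) +
      (\<Sum>i<?l. cs ! i * (x (i + ?q) ^ 2) $$ (n - 1)) = 0" for n
    using arg_cong[OF eq', of "\<lambda>f. f $$ n"] by (simp add: fls_nth_sum nthX)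
  \<comment> \<open>If all \<open>x i\<close> vanish below \<open>m\<close>, then coefficient \<open>2 * m\<close> of the form only involves the first
    block; once that block vanishes at \<open>m\<close> too, coefficient \<open>2 * m + 1\<close> only involves the second one.\<close>
  have coeff_step: "\<forall>i<?q + ?l. x i $$ m = 0" if low: "\<forall>i<?q + ?l. \<forall>n<m. x i $$ n = 0" for m
  proof -
    have sq: "(x i ^ 2) $$ (2 * m) = (x i $$ m) ^ 2" "(x i ^ 2) $$ (2 * m - 1) = 0"
      "x i $$ m = 0 \<Longrightarrow> (x i ^ 2) $$ (2 * m + 1) = 0" if "i < ?q + ?l" for i
      using low that by (auto intro: fls_square_nth[of m])
    have "(\<Sum>i<?q. as ! i * (x i $$ m) ^ 2) = 0"
      using eqn[of "2 * m"] by (simp add: sq)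
    then have a: "\<forall>i<?q. x i $$ m = 0"
      using assms(1) unfolding anisotropic_def by (elim allE[of _ "\<lambda>i. x i $$ m"]) auto
    have "(\<Sum>i<?l. cs ! i * (x (i + ?q) $$ m) ^ 2) = 0"
      using eqn[of "2 * m + 1"] a by (simp add: sq)
    then have c: "\<forall>i<?l. x (i + ?q) $$ m = 0"
      using assms(2) unfolding anisotropic_def by (elim allE[of _ "\<lambda>i. x (i + ?q) $$ m"]) auto
    show ?thesis
    proof (intro allI impI)
      fix i assume "i < ?q + ?l"
      then show "x i $$ m = 0" using a c[rule_format, of "i - ?q"] by (cases "i < ?q") auto
    qed
  qed
  define p where "p = Min (insert 0 ((\<lambda>i. fls_subdegree (x i)) ` {..<?q + ?l}))"
  have p: "x i $$ n = 0" if "i < ?q + ?l" "n < p" for i n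
  proof -
    have "p \<le> fls_subdegree (x i)" unfolding p_def using that by (intro Min_le) auto
    then show ?thesis using that by auto
  qed
  have all_below: "\<forall>i<?q + ?l. \<forall>n<m. x i $$ n = 0" if "p \<le> m" for m
    using that
  proof (induction m rule: int_ge_induct)
    case base
    then show ?case using p by auto
  next
    case (step m)
    then have "\<forall>i<?q + ?l. x i $$ m = 0" by (intro coeff_step)
    then show ?case using step by (metis zless_add1_eq)
  qed
  have "x i $$ n = 0" for n
    using all_below[of "max p (n + 1)", rule_format, of i n] i by simp
  then show "x i = 0" by (intro fls_zero_eqI)
qed

lemma no_rational_sqrt_half:
  fixes a :: real
  assumes "a \<in> \<rat>"
  shows "2 * a ^ 2 \<noteq> 1"
proof
  assume a: "2 * a ^ 2 = 1"
  obtain m n :: nat where mn: "n \<noteq> 0" "\<bar>a\<bar> = real m / real n" "coprime m n"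
    using Rats_abs_nat_div_natE[OF assms] by metis
  have "2 * (real m) ^ 2 = (real n) ^ 2"
  proof -
    have "a ^ 2 = real m ^ 2 / real n ^ 2" using mn(2) by (metis power2_abs power_divide)
    moreover have "a ^ 2 = 1 / 2" using a by simp
    ultimately show ?thesis using mn(1) by (simp add: field_simps)
  qed
  then have "real (2 * m ^ 2) = real (n ^ 2)" by simp
  then have eq: "2 * m ^ 2 = n ^ 2" using of_nat_eq_iff by blast
  then have "even (n ^ 2)" by (metis dvd_triv_left)
  then have "even n" by simp
  then obtain k where "n = 2 * k" by blast
  with eq have "m ^ 2 = 2 * k ^ 2" by (simp add: power_mult_distrib)
  then have "even (m ^ 2)" by simp
  then have "even m" by simp
  with \<open>even n\<close> mn(3) have "is_unit (2 :: nat)"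
    by (intro coprime_common_divisor)
  then show False by simp
qed

text \<open>
  Equivalently, neither \<open>\<iota>\<close> nor \<open>-\<iota>\<close> is a square: the real part of a root would be a rational
  square root of \<open>1/2\<close>.
\<close>
lemma gaussian_rat_no_primitive_8th_root:
  fixes u :: gaussian_rat
  shows "u ^ 4 \<noteq> - 1"
proof
  assume "u ^ 4 = - 1"
  then have "u * u * u * u = - 1" by (simp add: eval_nat_numeral mult.assoc)
  then obtain z :: complex where z: "Re z \<in> \<rat>" "Im z \<in> \<rat>" "z * z * z * z = - 1"
    by transfer blast
  define a b where "a = Re z" and "b = Im z"
  have "(z * z) * (z * z) = - 1" using z(3) by (simp add: mult.assoc)
  then have "(z * z) ^ 2 = \<i> ^ 2" by (simp add: power2_eq_square)
  then have "z * z = \<i> \<or> z * z = - \<i>" by (simp only: power2_eq_iff)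
  then have "a * a - b * b = 0" and ab: "2 * (a * b) = 1 \<or> 2 * (a * b) = - 1"
    by (auto simp: complex_eq_iff a_def b_def mult.commute)
  then have "(a - b) * (a + b) = 0" by (simp add: algebra_simps)
  then have "a = b \<or> a = - b" by auto
  then have "2 * a ^ 2 = 1 \<or> 2 * a ^ 2 = - 1" using ab by (auto simp: power2_eq_square)
  moreover have "2 * a ^ 2 \<noteq> - 1" using zero_le_power2[of a] by linarith
  ultimately show False using no_rational_sqrt_half[of a] z(1) by (simp add: a_def)
qed

lemma anisotropic_singleton: "c \<noteq> 0 \<Longrightarrow> anisotropic [c]"
  by (simp add: anisotropic_def)

lemma anisotropic_gaussian_rat:
  fixes c w :: gaussian_rat
  assumes "w ^ 2 = - 1" "c \<noteq> 0"
  shows "anisotropic [c, - c * w]"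
  unfolding anisotropic_def
proof (intro allI impI)
  fix x :: "nat \<Rightarrow> gaussian_rat" and i
  assume eq: "(\<Sum>i<length [c, - c * w]. [c, - c * w] ! i * x i ^ 2) = 0"
    and i: "i < length [c, - c * w]"
  have "c * (x 0 ^ 2 - w * x 1 ^ 2) = 0"
    using eq by (simp add: algebra_simps numeral_2_eq_2)
  then have x: "x 0 ^ 2 = w * x 1 ^ 2" using assms by simp
  have "x 1 = 0"
  proof (rule ccontr)
    assume "x 1 \<noteq> 0"
    then have "(x 0 / x 1) ^ 2 = w" using x by (simp add: power_divide)
    moreover have "(x 0 / x 1) ^ 4 = ((x 0 / x 1) ^ 2) ^ 2" by (simp flip: power_mult)
    ultimately have "(x 0 / x 1) ^ 4 = - 1" using assms(1) by simp
    then show False using gaussian_rat_no_primitive_8th_root by blast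
  qed
  with x i show "x i = 0" by (auto simp: less_Suc_eq)
qed

definition K_const :: "gaussian_rat \<Rightarrow> K_field" where
  "K_const e = fls_const (fls_const e)"

text \<open>
  Up to the substitutions \<open>s b3\<close> for \<open>b3\<close> and \<open>s v\<close> for \<open>v\<close>, which turn \<open>s\<^sup>2\<close> into a square
  factor, this form is \<open>(\<langle>1, -w\<rangle> \<bottom> s\<langle>-1, w\<rangle>) \<bottom> r (\<langle>e\<rangle> \<bottom> s\<langle>e\<rangle>)\<close>, to which Springer's theorem
  applies first for \<open>r\<close> and then for \<open>s\<close>.
\<close>
lemma quartic_form_anisotropic:
  fixes b0 b1 b2 b3 u v :: K_field
  assumes "w ^ 2 = - 1" "e \<noteq> 0"
    and eq: "b0 ^ 2 - K_s * b2 ^ 2 + K_const w * K_s * (b1 ^ 2 - K_s * b3 ^ 2)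
      + K_const e * (K_r * K_s) * (u ^ 2 + K_s * v ^ 2) = 0"
  shows "b0 = 0 \<and> b1 = 0 \<and> b2 = 0 \<and> b3 = 0 \<and> u = 0 \<and> v = 0"
proof -
  let ?X = "fls_X :: gaussian_rat fls"
  have q: "anisotropic ([fls_const 1, fls_const (- w)] @ [?X * fls_const (- 1), ?X * fls_const w])"
    using anisotropic_fls[OF anisotropic_gaussian_rat anisotropic_gaussian_rat, of w 1 w "- 1"] assms
    by simp
  have p: "anisotropic ([fls_const e] @ [?X * fls_const e])"
    using anisotropic_fls[OF anisotropic_singleton anisotropic_singleton, of e e] assms by simp
  define cs where "cs = [1, K_const (- w), - K_s, K_s * K_const w, K_r * K_const e, K_r * (K_s * K_const e)]"
  have cs: "anisotropic cs"
    using anisotropic_fls[OF q p]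
    by (simp add: K_const_def K_s_def K_r_def cs_def flip: fls_const_mult_const)
  define x where "x = (\<lambda>i. [b0, K_s * b3, b2, b1, K_s * v, u] ! i)"
  have "(\<Sum>i<length cs. cs ! i * x i ^ 2) =
     b0 ^ 2 - K_s * b2 ^ 2 + K_const w * K_s * (b1 ^ 2 - K_s * b3 ^ 2)
      + K_const e * (K_r * K_s) * (u ^ 2 + K_s * v ^ 2)"
    by (simp add: cs_def x_def eval_nat_numeral) (simp add: K_const_def algebra_simps)
  then have "\<forall>i<length cs. x i = 0"
    using cs eq unfolding anisotropic_def by metis
  then have "x 0 = 0" "x 1 = 0" "x 2 = 0" "x 3 = 0" "x 4 = 0" "x 5 = 0"
    by (auto simp: cs_def)
  moreover have "K_s \<noteq> 0" by (simp add: K_s_def)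
  ultimately show ?thesis by (simp add: x_def eval_nat_numeral)
qed

section \<open>The cyclic extension of degree four\<close>
lemma gaussian_i_square: "gaussian_i ^ 2 = - 1"
  unfolding power2_eq_square by transfer simp

lemma K_const_hom:
  "K_const (a + b) = K_const a + K_const b" "K_const (a * b) = K_const a * K_const b"
  "K_const (- a) = - K_const a" "K_const 1 = 1" "K_const 0 = 0"
  by (simp_all add: K_const_def fls_plus_const)

lemma K_iota_eq: "K_iota = K_const gaussian_i"
  by (simp add: K_iota_def K_const_def)

lemma K_iota_square: "K_iota ^ 2 = - 1"
  using arg_cong[OF gaussian_i_square, of K_const]
  by (simp add: K_iota_eq power2_eq_square K_const_hom)

lemma gaussian_rat_two_neq_0: "(2 :: gaussian_rat) \<noteq> 0"
proof -
  have "(1 + 1 :: gaussian_rat) \<noteq> 0" by transfer simp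
  then show ?thesis by simp
qed

lemma K_half: "K_const (1 / 2) * 2 = 1"
proof -
  have "K_const (1 / 2 * 2) = 1"
    using gaussian_rat_two_neq_0 by (simp add: K_const_hom)
  moreover have "K_const 2 = 2" by (simp add: K_const_def)
  ultimately show ?thesis by (simp only: K_const_hom)
qed

lemma K_two_neq_0: "(2 :: K_field) \<noteq> 0"
  using K_half by auto

lemma K_iota_neq_0: "K_iota \<noteq> 0"
  using K_iota_square by auto

lemma K_s_neq_0: "K_s \<noteq> 0"
  by (simp add: K_s_def)

lemma K_s_neq_1: "K_s \<noteq> 1"
proof
  assume "K_s = 1"
  then have "(fls_X :: gaussian_rat fls) = 1" by (simp add: K_s_def)
  then have "(fls_X :: gaussian_rat fls) $$ 0 = 1 $$ 0" by simp
  then show False by simp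
qed

lemma K_neq_minus: "(a :: K_field) = - a \<longleftrightarrow> a = 0"
proof -
  have "a = - a \<longleftrightarrow> 2 * a = 0" by (metis add_eq_0_iff2 mult_2)
  then show ?thesis using K_two_neq_0 by simp
qed

lemma K_iota_neq: "K_iota \<noteq> 1" "K_iota \<noteq> - 1"
proof -
  have "K_iota ^ 2 \<noteq> 1" unfolding K_iota_square using K_neq_minus[of 1] by simp
  moreover have "(- 1 :: K_field) ^ 2 = 1" by simp
  ultimately show "K_iota \<noteq> 1" "K_iota \<noteq> - 1" by fastforce+
qed

locale quartic_extension = field_automorphism \<sigma> for \<sigma> :: "'f :: field \<Rightarrow> 'f" +
  fixes emb :: "K_field \<Rightarrow> 'f" and y :: 'f
  assumes emb_add: "emb (a + b) = emb a + emb b"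
    and emb_mult: "emb (a * b) = emb a * emb b"
    and emb_one [simp]: "emb 1 = 1"
    and y4: "y ^ 4 = emb K_s"
    and generates: "generate_field ring_of_type_algebra (insert y (range emb)) = UNIV"
    and fixes_emb: "\<sigma> (emb c) = emb c"
    and \<sigma>_y: "\<sigma> y = emb K_iota * y"
begin

lemma emb_zero [simp]: "emb 0 = 0"
  using emb_add[of 0 0] by (metis add.right_neutral add_left_cancel)

lemma emb_minus: "emb (- a) = - emb a"
  using emb_add[of a "- a"] by (simp add: add_eq_0_iff)

lemma emb_eq_0_iff [simp]: "emb a = 0 \<longleftrightarrow> a = 0"
proof
  assume "emb a = 0"
  then have "emb (a * inverse a) = 0" by (simp add: emb_mult)
  then show "a = 0" by (cases "a = 0") auto
qed simp

lemma emb_eq_iff [simp]: "emb a = emb b \<longleftrightarrow> a = b"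
  using emb_eq_0_iff[of "a - b"] emb_add[of "a - b" b] by auto

lemma emb_sum: "emb (sum g I) = (\<Sum>i\<in>I. emb (g i))"
  by (induction I rule: infinite_finite_induct) (auto simp: emb_add)

lemma two_neq_0: "(2 :: 'f) \<noteq> 0"
proof -
  have "emb 2 = 2" using emb_add[of 1 1] by simp
  moreover have "emb 2 \<noteq> 0" using K_two_neq_0 by simp
  ultimately show ?thesis by metis
qed

lemma emb_iota_square: "emb K_iota * emb K_iota = - 1"
  using K_iota_square by (simp add: power2_eq_square emb_minus flip: emb_mult)

lemma y_neq_0: "y \<noteq> 0"
  using y4 K_s_neq_0 by auto

definition qd :: "K_field \<Rightarrow> K_field \<Rightarrow> K_field \<Rightarrow> K_field \<Rightarrow> 'f" where
  "qd a0 a1 a2 a3 = emb a0 + emb a1 * y + emb a2 * y ^ 2 + emb a3 * y ^ 3"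

lemma qd_add: "qd a0 a1 a2 a3 + qd b0 b1 b2 b3 = qd (a0 + b0) (a1 + b1) (a2 + b2) (a3 + b3)"
  by (simp add: qd_def emb_add algebra_simps)

lemma qd_minus: "- qd a0 a1 a2 a3 = qd (- a0) (- a1) (- a2) (- a3)"
  by (simp add: qd_def emb_minus algebra_simps)

lemma qd_mult: "qd a0 a1 a2 a3 * qd b0 b1 b2 b3 =
  qd (a0 * b0 + K_s * (a1 * b3 + a2 * b2 + a3 * b1)) (a0 * b1 + a1 * b0 + K_s * (a2 * b3 + a3 * b2))
    (a0 * b2 + a1 * b1 + a2 * b0 + K_s * (a3 * b3)) (a0 * b3 + a1 * b2 + a2 * b1 + a3 * b0)"
  by (simp add: qd_def emb_add emb_mult algebra_simps eval_nat_numeral flip: y4)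

lemma \<sigma>_qd: "\<sigma> (qd a0 a1 a2 a3) = qd a0 (K_iota * a1) (- a2) (- K_iota * a3)"
proof -
  have "\<sigma> (y ^ 2) = (emb K_iota * emb K_iota) * y ^ 2"
    "\<sigma> (y ^ 3) = (emb K_iota * emb K_iota) * (emb K_iota * y ^ 3)"
    by (simp_all add: power2_eq_square power3_eq_cube mult \<sigma>_y)
  then have "\<sigma> (y ^ 2) = - (y ^ 2)" "\<sigma> (y ^ 3) = - (emb K_iota * y ^ 3)"
    unfolding emb_iota_square by simp_all
  then show ?thesis
    by (simp add: qd_def add mult fixes_emb \<sigma>_y emb_mult emb_minus)
qed

text \<open>
  The powers of \<open>y\<close> are independent because \<open>1, y, y\<^sup>2, y\<^sup>3\<close> are eigenvectors of \<open>\<sigma>\<close> for the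
  distinct eigenvalues \<open>1, \<iota>, -1, -\<iota>\<close>; in particular \<open>Y\<^sup>4 - s\<close> is irreducible over \<open>K\<close>.
\<close>
lemma qd_eq_0_iff: "qd a0 a1 a2 a3 = 0 \<longleftrightarrow> a0 = 0 \<and> a1 = 0 \<and> a2 = 0 \<and> a3 = 0"
proof
  let ?\<iota> = "emb K_iota"
  assume z: "qd a0 a1 a2 a3 = 0"
  define t0 t1 t2 t3 where "t0 = emb a0" and "t1 = emb a1 * y" and "t2 = emb a2 * y ^ 2"
    and "t3 = emb a3 * y ^ 3"
  note t = t0_def t1_def t2_def t3_def
  have "\<sigma> (qd a0 a1 a2 a3) = 0" "\<sigma> (\<sigma> (qd a0 a1 a2 a3)) = 0" "\<sigma> (\<sigma> (\<sigma> (qd a0 a1 a2 a3))) = 0"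
    using z by (simp_all add: zero)
  note h = z this[unfolded \<sigma>_qd, unfolded qd_def emb_mult emb_minus]
  note i = emb_iota_square
  have "t0 + (?\<iota> * ?\<iota>) * t1 + t2 + (?\<iota> * ?\<iota>) * t3 = 0"
    "t0 + (?\<iota> * ?\<iota>) * ?\<iota> * t1 - t2 - (?\<iota> * ?\<iota>) * ?\<iota> * t3 = 0"
    using h(3,4) by (simp_all add: t algebra_simps)
  then have e34: "t0 - t1 + t2 - t3 = 0" "t0 - ?\<iota> * t1 - t2 + ?\<iota> * t3 = 0"
    unfolding i by simp_all
  have e12: "t0 + t1 + t2 + t3 = 0" "t0 + ?\<iota> * t1 - t2 - ?\<iota> * t3 = 0"
    using h(1,2) by (simp_all add: t qd_def algebra_simps)
  have "2 * (t0 + t2) = (t0 + t1 + t2 + t3) + (t0 - t1 + t2 - t3)"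
    "2 * (t1 + t3) = (t0 + t1 + t2 + t3) - (t0 - t1 + t2 - t3)"
    "2 * (t0 - t2) = (t0 + ?\<iota> * t1 - t2 - ?\<iota> * t3) + (t0 - ?\<iota> * t1 - t2 + ?\<iota> * t3)"
    "2 * (?\<iota> * (t1 - t3)) =
      (t0 + ?\<iota> * t1 - t2 - ?\<iota> * t3) - (t0 - ?\<iota> * t1 - t2 + ?\<iota> * t3)"
    by (simp_all add: algebra_simps)
  moreover have "(4 :: 'f) = 2 * 2" by simp
  then have "(4 :: 'f) \<noteq> 0" using two_neq_0 by (metis mult_eq_0_iff)
  ultimately have "t0 + t2 = 0" "t1 + t3 = 0" "t0 - t2 = 0" "t1 - t3 = 0"
    unfolding e12 e34 using two_neq_0 K_iota_neq_0 by simp_all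
  then have "2 * t0 = 0" "2 * t2 = 0" "2 * t1 = 0" "2 * t3 = 0"
    unfolding mult_2 by (simp_all add: add_eq_0_iff)
  then show "a0 = 0 \<and> a1 = 0 \<and> a2 = 0 \<and> a3 = 0"
    using two_neq_0 y_neq_0 by (simp add: t)
qed (simp add: qd_def)

lemma qd_eq_iff: "qd a0 a1 a2 a3 = qd b0 b1 b2 b3 \<longleftrightarrow> a0 = b0 \<and> a1 = b1 \<and> a2 = b2 \<and> a3 = b3"
  using qd_eq_0_iff[of "a0 - b0" "a1 - b1" "a2 - b2" "a3 - b3"]
    qd_add[of "a0 - b0" "a1 - b1" "a2 - b2" "a3 - b3" b0 b1 b2 b3]
  by auto

text \<open>
  The norm \<open>a \<sigma>(a) \<sigma>\<^sup>2(a) \<sigma>\<^sup>3(a)\<close> is fixed by \<open>\<sigma>\<close>, hence lies in \<open>K\<close>; so the \<open>K\<close>-span of the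
  powers of \<open>y\<close> is closed under inverses and is all of \<open>F\<close>.
\<close>
lemma qd_inverse:
  assumes "a \<noteq> 0" "a \<in> {qd a0 a1 a2 a3 | a0 a1 a2 a3. True}"
  shows "inverse a \<in> {qd a0 a1 a2 a3 | a0 a1 a2 a3. True}"
proof -
  let ?S = "{qd a0 a1 a2 a3 | a0 a1 a2 a3. True}"
  have m: "b * c \<in> ?S" if "b \<in> ?S" "c \<in> ?S" for b c
    using that qd_mult by blast
  have s: "\<sigma> b \<in> ?S" if "b \<in> ?S" for b
    using that \<sigma>_qd by blast
  define c where "c = \<sigma> a * \<sigma> (\<sigma> a) * \<sigma> (\<sigma> (\<sigma> a))"
  have cS: "c \<in> ?S" unfolding c_def by (intro m s assms)
  have "\<sigma> (\<sigma> (\<sigma> (\<sigma> a))) = a"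
    using assms(2) K_iota_square by (auto simp: \<sigma>_qd power2_eq_square mult.assoc[symmetric])
  then have fixed: "\<sigma> (a * c) = a * c" by (simp add: c_def mult mult_ac)
  obtain n0 n1 n2 n3 where n: "a * c = qd n0 n1 n2 n3" using m[OF assms(2) cS] by blast
  have iota: "K_iota \<noteq> 1" "K_iota \<noteq> - 1" by (rule K_iota_neq)+
  from fixed have "n1 = K_iota * n1" "n2 = - n2" "n3 = - K_iota * n3"
    unfolding n \<sigma>_qd qd_eq_iff by auto
  then have "(1 - K_iota) * n1 = 0" "n2 = 0" "(1 + K_iota) * n3 = 0"
    using K_neq_minus[of n2] by (simp_all add: algebra_simps add_eq_0_iff2)
  moreover have "1 - K_iota \<noteq> 0" "1 + K_iota \<noteq> 0"
    using iota by (auto simp: add_eq_0_iff)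
  ultimately have "n1 = 0" "n2 = 0" "n3 = 0" by simp_all
  then have ac: "a * c = emb n0" using n by (simp add: qd_def)
  have "a * c \<noteq> 0" using assms(1) by (simp add: c_def eq_0_iff)
  then have n0: "n0 \<noteq> 0" using ac by auto
  have "a * (c * emb (inverse n0)) = 1"
    using ac n0 by (simp add: mult.assoc[symmetric] flip: emb_mult)
  then have "inverse a = c * emb (inverse n0)"
    by (rule inverse_unique)
  also have "emb (inverse n0) = qd (inverse n0) 0 0 0" by (simp add: qd_def)
  finally show ?thesis using m[OF cS, of "qd (inverse n0) 0 0 0"] by auto
qed

lemma qd_surj: "\<exists>a0 a1 a2 a3. a = qd a0 a1 a2 a3"
proof -
  let ?S = "{qd a0 a1 a2 a3 | a0 a1 a2 a3. True}"
  let ?R = "ring_of_type_algebra :: 'f ring"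
  interpret R: field ?R by (rule field_from_type_algebra)
  have "a \<in> generate_field ?R (insert y (range emb))" by (simp add: generates)
  then have "a \<in> ?S"
  proof induction
    case one
    have "\<one>\<^bsub>?R\<^esub> = qd 1 0 0 0" by (simp add: qd_def ring_of_type_algebra_def)
    then show ?case by blast
  next
    case (incl h)
    have "y = qd 0 1 0 0" "emb c = qd c 0 0 0" for c by (simp_all add: qd_def)
    then show ?case using incl by blast
  next
    case (a_inv h)
    have "\<ominus>\<^bsub>?R\<^esub> h = - h"
      by (rule R.minus_equality) (auto simp: ring_of_type_algebra_def)
    moreover have "- h \<in> ?S" using a_inv(2) qd_minus by blast
    ultimately show ?case by simp
  next
    case (m_inv h)
    then have h: "h \<noteq> 0" by (simp add: ring_of_type_algebra_def)
    have "inv\<^bsub>?R\<^esub> h = inverse h"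
      by (rule R.comm_inv_char) (use h in \<open>auto simp: ring_of_type_algebra_def\<close>)
    then show ?case using qd_inverse[OF h m_inv(3)] by simp
  next
    case (eng_add h1 h2)
    then have "h1 + h2 \<in> ?S" using qd_add by blast
    then show ?case by (simp add: ring_of_type_algebra_def)
  next
    case (eng_mult h1 h2)
    then have "h1 * h2 \<in> ?S" using qd_mult by blast
    then show ?case by (simp add: ring_of_type_algebra_def)
  qed
  then show ?thesis by blast
qed

text \<open>
  The coordinates of an element of \<open>F\<close> with respect to \<open>1, y, y\<^sup>2, y\<^sup>3\<close>. Since \<open>\<sigma>\<close> multiplies
  the others by nontrivial roots of unity, \<open>co 0\<close> is a quarter of the trace from \<open>F\<close> to \<open>K\<close>.
\<close>
definition co :: "nat \<Rightarrow> 'f \<Rightarrow> K_field" where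
  "co k a = (THE c. \<exists>a0 a1 a2 a3. a = qd a0 a1 a2 a3 \<and> c = [a0, a1, a2, a3] ! k)"

lemma co_qd: "co k (qd a0 a1 a2 a3) = [a0, a1, a2, a3] ! k"
  unfolding co_def by (rule the_equality) (auto simp: qd_eq_iff)

lemma co_qd_simps [simp]:
  "co 0 (qd a0 a1 a2 a3) = a0" "co 1 (qd a0 a1 a2 a3) = a1" "co (Suc 0) (qd a0 a1 a2 a3) = a1"
  "co 2 (qd a0 a1 a2 a3) = a2" "co 3 (qd a0 a1 a2 a3) = a3"
  by (simp_all add: co_qd eval_nat_numeral)

lemma qd_co: "qd (co 0 a) (co 1 a) (co 2 a) (co 3 a) = a"
  using qd_surj[of a] by auto

lemma co_linear:
  assumes "k < 4"
  shows "co k (a + b) = co k a + co k b" "co k (emb c * a) = c * co k a"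
proof -
  obtain a0 a1 a2 a3 b0 b1 b2 b3 where a: "a = qd a0 a1 a2 a3" and b: "b = qd b0 b1 b2 b3"
    using qd_surj by metis
  have c: "emb c = qd c 0 0 0" by (simp add: qd_def)
  have k: "k = 0 \<or> k = 1 \<or> k = 2 \<or> k = 3" using assms by auto
  show "co k (a + b) = co k a + co k b" using k by (auto simp: a b qd_add)
  show "co k (emb c * a) = c * co k a" using k by (auto simp: a c qd_mult)
qed

lemma co_zero: "k < 4 \<Longrightarrow> co k 0 = 0"
  using co_linear(2)[of k 0 0] by simp

lemma co_sum: "k < 4 \<Longrightarrow> co k (sum g I) = (\<Sum>i\<in>I. co k (g i))"
  by (induction I rule: infinite_finite_induct) (auto simp: co_linear co_zero)

lemma pw_emb [simp]: "pw m (emb c) = emb c"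
proof (induction m rule: int_induct[of _ 0])
  case (step1 i)
  then show ?case by (simp add: int_funpow_Suc[OF bij] fixes_emb)
next
  case (step2 i)
  have "\<sigma> (pw (i - 1) (emb c)) = \<sigma> (emb c)"
    using int_funpow_Suc[OF bij, of "i - 1" "emb c"] step2 by (simp add: fixes_emb)
  then show ?case using bij by (simp add: bij_def inj_eq)
qed simp

lemma pw_y: "pw m y = emb (K_iota powi m) * y"
proof (induction m rule: int_induct[of _ 0])
  case (step1 i)
  then show ?case using K_iota_neq_0
    by (simp add: int_funpow_Suc[OF bij] mult fixes_emb \<sigma>_y power_int_add emb_mult)
next
  case (step2 i)
  have "K_iota powi i = K_iota powi (i - 1) * K_iota"
    using K_iota_neq_0 by (simp add: power_int_diff)
  then have "\<sigma> (pw (i - 1) y) = \<sigma> (emb (K_iota powi (i - 1)) * y)"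
    using int_funpow_Suc[OF bij, of "i - 1" y] step2
    by (simp add: mult fixes_emb \<sigma>_y emb_mult mult.assoc)
  then show ?case using bij by (simp add: bij_def inj_eq)
qed simp

lemma pw_qd: "pw m (qd a0 a1 a2 a3) =
   qd a0 (K_iota powi m * a1) ((K_iota powi m) ^ 2 * a2) ((K_iota powi m) ^ 3 * a3)"
  by (simp add: qd_def pw_add pw_mult pw_power pw_y emb_mult power_mult_distrib mult_ac eval_nat_numeral)

lemma co_pw: "co 0 (pw m a) = co 0 a"
  using qd_surj[of a] by (auto simp: pw_qd)

lemma K_iota_powi_square: "(K_iota powi m) ^ 2 = (if even m then 1 else - 1)"
proof -
  have "(K_iota powi m) ^ 2 = (K_iota ^ 2) powi m"
    by (metis power_int_mult_distrib power2_eq_square)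
  then show ?thesis by (simp add: K_iota_square power_int_minus_one_minus power_int_minus_left)
qed

lemma K_iota_powi_odd: "odd m \<Longrightarrow> \<exists>w. w ^ 2 = - 1 \<and> K_iota powi m = K_const w"
proof -
  assume "odd m"
  then have "(K_iota powi m) ^ 2 = K_iota ^ 2"
    by (simp add: K_iota_powi_square K_iota_square)
  then have "K_iota powi m = K_const gaussian_i \<or> K_iota powi m = K_const (- gaussian_i)"
    by (simp add: power2_eq_iff K_iota_eq K_const_hom)
  moreover have "(- gaussian_i) ^ 2 = - 1" using gaussian_i_square by simp
  ultimately show ?thesis using gaussian_i_square by blast
qed

lemma K_iota_powi_4: "4 dvd m \<Longrightarrow> K_iota powi m = 1"
proof -
  have "K_iota ^ 4 = (K_iota ^ 2) ^ 2" by (simp flip: power_mult)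
  then have "K_iota ^ 4 = 1" by (simp add: K_iota_square)
  then show "K_iota powi m = 1" if "4 dvd m" using that by (auto simp: power_int_mult)
qed

lemma pw_4: "4 dvd m \<Longrightarrow> pw m a = a"
  using qd_surj[of a] by (auto simp: pw_qd K_iota_powi_4)

lemma pw_mod_4: "4 dvd m - n \<Longrightarrow> pw m a = pw n a"
  using pw_4[of "m - n" "pw n a"] by (simp add: pw_pw)

lemma pw_2_qd: "pw 2 (qd a0 a1 a2 a3) = qd a0 (- a1) a2 (- a3)"
  by (simp add: pw_qd K_iota_square)

end

section \<open>The centralizer of a factor of the commutator\<close>

context quartic_extension
begin

definition witness :: "'f fls" where
  "witness = skew_monom (1 + y ^ 2) (- 2) + skew_monom (emb K_r / 2 * y ^ 2) 0"

lemma one_plus_y2: "1 + y ^ 2 = qd 1 0 1 0"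
  by (simp add: qd_def)

lemma r_half_y2: "emb K_r / 2 * y ^ 2 = qd 0 0 (K_const (1 / 2) * K_r) 0"
proof -
  have "emb (K_const (1 / 2) * 2) = 1" unfolding K_half by simp
  then have "emb (K_const (1 / 2)) * 2 = 1"
    using emb_add[of 1 1] by (simp add: emb_mult)
  then have "emb (K_const (1 / 2)) = 1 / 2" using two_neq_0 by (simp add: field_simps)
  then show ?thesis by (simp add: qd_def emb_mult)
qed

lemma nth_witness_mult:
  "(witness \<star> d) $$ n = (1 + y ^ 2) * pw 2 (d $$ (n + 2)) + emb K_r / 2 * y ^ 2 * d $$ n"
  using pw_mod_4[of "- 2" 2] by (simp add: witness_def skew_distrib_right nth_monom_mult)

lemma nth_mult_witness:
  "(d \<star> witness) $$ n = d $$ (n + 2) * pw (n + 2) (1 + y ^ 2) + d $$ n * pw n (emb K_r / 2 * y ^ 2)"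
  by (simp add: witness_def skew_distrib_left nth_mult_monom)

lemma witness_neq_0: "witness \<noteq> 0"
proof -
  have "witness $$ (- 2) = qd 1 0 1 0"
    by (simp add: witness_def fls_nth_skew_monom one_plus_y2)
  then have "witness $$ (- 2) \<noteq> 0" by (simp add: qd_eq_0_iff)
  then show ?thesis by auto
qed

lemma co_0_witness_mult:
  "co 0 ((witness \<star> d) $$ n) =
     co 0 (d $$ (n + 2)) + K_s * co 2 (d $$ (n + 2)) + K_const (1 / 2) * (K_r * K_s) * co 2 (d $$ n)"
proof -
  obtain a0 a1 a2 a3 b0 b1 b2 b3
    where a: "d $$ (n + 2) = qd a0 a1 a2 a3" and b: "d $$ n = qd b0 b1 b2 b3"
    using qd_surj by metis
  show ?thesis
    unfolding nth_witness_mult a b one_plus_y2 r_half_y2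
    by (simp add: pw_2_qd qd_mult qd_add)
qed

text \<open>
  Reduced traces of commutators vanish: at an index divisible by 4, \<open>co 0\<close> of the coefficient
  is a quarter of the coefficient of the reduced trace. Corresponding summands of \<open>BC\<close> and
  \<open>CB\<close> are conjugate under a power of \<open>\<sigma>\<close>.
\<close>
lemma co_0_mult_commute:
  assumes "4 dvd n"
  shows "co 0 ((B \<star> C) $$ n) = co 0 ((C \<star> B) $$ n)"
proof -
  let ?I = "{fls_subdegree B..n - fls_subdegree C}"
  have swap: "co 0 (B $$ i * pw i (C $$ (n - i))) = co 0 (C $$ (n - i) * pw (n - i) (B $$ i))" for i
  proof -
    have "pw (n - i) (B $$ i) = pw (- i) (B $$ i)" using assms by (intro pw_mod_4) auto
    then have "pw i (C $$ (n - i) * pw (n - i) (B $$ i)) = B $$ i * pw i (C $$ (n - i))"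
      by (simp add: pw_mult pw_pw)
    then show ?thesis by (metis co_pw)
  qed
  have "(C \<star> B) $$ n = (\<Sum>j\<in>{fls_subdegree C..n - fls_subdegree B}. C $$ j * pw j (B $$ (n - j)))"
    by (rule fls_nth_skew_mult)
  also have "\<dots> = (\<Sum>i\<in>?I. C $$ (n - i) * pw (n - i) (B $$ i))"
    by (rule sum.reindex_bij_witness[of _ "\<lambda>i. n - i" "\<lambda>i. n - i"]) auto
  finally show ?thesis by (simp add: fls_nth_skew_mult[of \<sigma> B C] co_sum swap)
qed

text \<open>
  For odd \<open>m\<close> the root of unity \<open>w = \<iota>\<^sup>m\<close> satisfies \<open>w\<^sup>2 = -1\<close>, and in \<open>b \<sigma>\<^sup>m(b)\<close> the mixed
  products \<open>b1 b3\<close> and \<open>b0 b2\<close> cancel from the coordinates at \<open>1\<close> and \<open>y\<^sup>2\<close>. What remains is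
  the anisotropic diagonal form.
\<close>
lemma odd_twisted_square:
  assumes "odd m" "co 0 (b * pw m b) + K_s * co 2 (b * pw m b) + K_const e * (K_r * K_s) * (u ^ 2 + K_s * v ^ 2) = 0"
    "e \<noteq> 0"
  shows "b = 0 \<and> u = 0 \<and> v = 0"
proof -
  obtain b0 b1 b2 b3 where b: "b = qd b0 b1 b2 b3" using qd_surj by metis
  obtain w where w: "w ^ 2 = - 1" "K_iota powi m = K_const w"
    using K_iota_powi_odd[OF assms(1)] by blast
  have sq: "(K_const w) ^ 2 = - 1" using K_iota_powi_square[of m] assms(1) w by simp
  have cube: "(K_const w) ^ 3 = - K_const w"
    using sq by (simp add: power3_eq_cube power2_eq_square)
  have "b0 ^ 2 - K_s * b2 ^ 2 + K_const w * K_s * (b1 ^ 2 - K_s * b3 ^ 2) =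
      co 0 (b * pw m b) + K_s * co 2 (b * pw m b)"
    unfolding b pw_qd w(2) sq cube qd_mult co_qd_simps
    by (simp add: algebra_simps power2_eq_square)
  then have "b0 = 0 \<and> b1 = 0 \<and> b2 = 0 \<and> b3 = 0 \<and> u = 0 \<and> v = 0"
    using assms w by (intro quartic_form_anisotropic[of w e]) auto
  then show ?thesis by (simp add: b qd_eq_0_iff)
qed

text \<open>
  The elements of \<open>K((x\<^sup>4))\<close>, the center of \<open>D\<close>.
\<close>
definition central :: "'f fls \<Rightarrow> bool" where
  "central z \<longleftrightarrow> (\<forall>n. z $$ n \<noteq> 0 \<longrightarrow> 4 dvd n \<and> z $$ n \<in> range emb)"

lemma central_pw: "central z \<Longrightarrow> pw j (z $$ n) = z $$ n"
  by (cases "z $$ n = 0") (auto simp: central_def)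

lemma nth_central_mult:
  assumes "central z" "finite I" "\<And>i. i \<notin> I \<Longrightarrow> z $$ i = 0 \<or> d $$ (n - i) = 0"
  shows "(z \<star> d) $$ n = (\<Sum>i\<in>I. z $$ i * d $$ (n - i))"
proof -
  have "z $$ i * pw i (d $$ (n - i)) = z $$ i * d $$ (n - i)" for i
    using assms(1) by (cases "z $$ i = 0") (auto simp: central_def pw_4)
  then have "(\<Sum>i\<in>I. z $$ i * pw i (d $$ (n - i))) = (\<Sum>i\<in>I. z $$ i * d $$ (n - i))"
    by (intro sum.cong refl)
  then show ?thesis using nth_skew_mult[OF assms(2,3)] by (rule trans[rotated])
qed

lemma central_commute:
  assumes "central z"
  shows "z \<star> d = d \<star> z"
proof (rule fls_eqI)
  fix n
  have "(z \<star> d) $$ n = (\<Sum>i\<in>{fls_subdegree z..n - fls_subdegree d}. z $$ i * d $$ (n - i))"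
    by (rule nth_central_mult) (use assms in auto)
  also have "\<dots> = (\<Sum>j\<in>{fls_subdegree d..n - fls_subdegree z}. z $$ (n - j) * d $$ j)"
    by (rule sum.reindex_bij_witness[of _ "\<lambda>i. n - i" "\<lambda>i. n - i"]) auto
  also have "\<dots> = (d \<star> z) $$ n"
    by (simp add: fls_nth_skew_mult central_pw[OF assms] mult.commute)
  finally show "(z \<star> d) $$ n = (d \<star> z) $$ n" .
qed

text \<open>
  The coordinate functionals of \<open>D\<close> over its center \<open>K((x\<^sup>4))\<close> for the basis elements \<open>y\<^sup>k x\<^sup>l\<close>.
  Here only those for \<open>1\<close>, \<open>y\<^sup>2\<close> and \<open>y\<^sup>2 x\<^sup>2\<close> are used.
\<close>
definition component :: "int \<Rightarrow> nat \<Rightarrow> 'f fls \<Rightarrow> 'f fls" where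
  "component l k d = Abs_fls (\<lambda>n. if 4 dvd n then emb (co k (d $$ (n + l))) else 0)"

lemma nth_component:
  assumes "k < 4"
  shows "component l k d $$ n = (if 4 dvd n then emb (co k (d $$ (n + l))) else 0)"
  unfolding component_def
  by (rule nth_Abs_fls_lower_bound[of "fls_subdegree d - l"]) (simp add: co_zero assms)

lemma central_component: "k < 4 \<Longrightarrow> central (component l k d)"
  by (auto simp: central_def nth_component)

lemma component_diff: "k < 4 \<Longrightarrow> component l k (a - b) = component l k a - component l k b"
proof -
  assume k: "k < 4"
  have "co k (a - b) = co k a - co k b" for a b
    using co_linear(1)[OF k, of "a - b" b] by simp
  moreover have "emb (a - b) = emb a - emb b" for a b
    using emb_add[of "a - b" b] by simp
  ultimately show ?thesis by (auto intro!: fls_eqI simp: nth_component k)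
qed

lemma component_central_mult:
  assumes z: "central z" and k: "k < 4"
  shows "component l k (z \<star> d) = z \<star> component l k d"
proof (rule fls_eqI)
  fix n
  let ?c = "component l k d"
  let ?I = "{fls_subdegree z..max (n + l - fls_subdegree d) (n - fls_subdegree ?c)}"
  have co_z: "emb (co k (z $$ i * a)) = z $$ i * emb (co k a)" for i a
    using z by (cases "z $$ i = 0") (auto simp: central_def co_linear co_zero k emb_mult)
  have "(z \<star> d) $$ (n + l) = (\<Sum>i\<in>?I. z $$ i * d $$ (n + l - i))"
    by (rule nth_central_mult) (use z in auto)
  then have 1: "emb (co k ((z \<star> d) $$ (n + l))) = (\<Sum>i\<in>?I. z $$ i * emb (co k (d $$ (n + l - i))))"
    by (simp add: co_sum k emb_sum co_z)
  have "(z \<star> ?c) $$ n = (\<Sum>i\<in>?I. z $$ i * ?c $$ (n - i))"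
    by (rule nth_central_mult) (use z in auto)
  also have "\<dots> = (\<Sum>i\<in>?I. if 4 dvd n then z $$ i * emb (co k (d $$ (n + l - i))) else 0)"
  proof (rule sum.cong[OF refl])
    fix i
    have "4 dvd n - i \<longleftrightarrow> 4 dvd n" if "4 dvd i" using that by (simp add: dvd_diff_commute dvd_diff_right_iff)
    then show "z $$ i * ?c $$ (n - i) = (if 4 dvd n then z $$ i * emb (co k (d $$ (n + l - i))) else 0)"
      using z by (cases "z $$ i = 0") (auto simp: central_def nth_component k algebra_simps)
  qed
  finally show "component l k (z \<star> d) $$ n = (z \<star> ?c) $$ n"
    using 1 by (simp add: nth_component k)
qed

lemma component_central:
  assumes "central z"
  shows "component 0 0 z = z" "l \<in> {0, 2} \<Longrightarrow> component l 2 z = 0"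
proof -
  have c: "co 0 (emb a) = a" "co 2 (emb a) = 0" for a
    using co_qd_simps(1,4)[of a 0 0 0] by (simp_all add: qd_def)
  have "emb (co 0 (z $$ n)) = z $$ n \<and> co 2 (z $$ n) = 0" for n
  proof (cases "z $$ n = 0")
    case False
    then obtain a where "z $$ n = emb a" using assms unfolding central_def by blast
    then show ?thesis by (simp add: c)
  qed (simp add: co_zero)
  then show "component 0 0 z = z" "l \<in> {0, 2} \<Longrightarrow> component l 2 z = 0"
    using assms by (auto intro!: fls_eqI simp: nth_component central_def)
qed

context
  fixes B C :: "'f fls"
  assumes commutator: "witness = B \<star> C - C \<star> B"
begin

text \<open>
  If \<open>b\<close> commutes with \<open>B\<close>, then \<open>[B, C] b = [B, C b]\<close> is again a commutator, so its reduced
  trace vanishes. The equation is this condition written out in coordinates.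
\<close>
lemma orthogonal_centralizer:
  assumes "b \<star> B = B \<star> b" "4 dvd n"
  shows "co 0 (b $$ (n + 2)) + K_s * co 2 (b $$ (n + 2)) + K_const (1 / 2) * (K_r * K_s) * co 2 (b $$ n) = 0"
proof -
  have "C \<star> B \<star> b = C \<star> b \<star> B" by (simp add: skew_assoc assms(1))
  then have eq: "witness \<star> b + (C \<star> b) \<star> B = B \<star> (C \<star> b)"
    by (simp add: commutator skew_diff skew_assoc)
  have "co 0 ((witness \<star> b) $$ n) + co 0 ((C \<star> b \<star> B) $$ n) = co 0 ((B \<star> (C \<star> b)) $$ n)"
    unfolding eq[symmetric] by (simp add: co_linear)
  then have "co 0 ((witness \<star> b) $$ n) = 0"
    using co_0_mult_commute[OF assms(2), of B "C \<star> b"] by simp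
  then show ?thesis by (simp add: co_0_witness_mult)
qed

lemma square_in_centralizer: "b \<star> B = B \<star> b \<Longrightarrow> b \<star> b \<star> B = B \<star> (b \<star> b)"
  by (metis skew_assoc)

text \<open>
  For \<open>b\<close> of odd order \<open>m\<close>, the condition on \<open>b\<^sup>2\<close> at the index \<open>2 m - 2\<close>, which is divisible
  by 4, involves only its leading coefficient \<open>b\<^sub>m \<sigma>\<^sup>m(b\<^sub>m)\<close>.
\<close>
lemma centralizer_even_order:
  assumes b: "b \<star> B = B \<star> b" "b \<noteq> 0"
  shows "even (fls_subdegree b)"
proof (rule ccontr)
  assume odd: "odd (fls_subdegree b)"
  define m where "m = fls_subdegree b"
  have idx: "2 * m - 2 + 2 = m + m" by simp
  have "4 dvd 2 * m - 2" using odd unfolding m_def by presburger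
  then have "co 0 ((b \<star> b) $$ (m + m)) + K_s * co 2 ((b \<star> b) $$ (m + m)) +
      K_const (1 / 2) * (K_r * K_s) * co 2 ((b \<star> b) $$ (2 * m - 2)) = 0"
    using orthogonal_centralizer[OF square_in_centralizer[OF b(1)], of "2 * m - 2"]
    by (simp only: idx)
  moreover have "(b \<star> b) $$ (m + m) = b $$ m * pw m (b $$ m)"
    by (rule nth_skew_mult_lead) (auto simp: m_def)
  moreover have "(b \<star> b) $$ (2 * m - 2) = 0"
    by (rule nth_skew_mult_eq_0[of m _ m]) (auto simp: m_def)
  ultimately have "b $$ m = 0"
    using odd_twisted_square[of m "b $$ m" 1 0 0] odd by (simp add: co_zero flip: m_def)
  then show False using b(2) by (simp add: m_def)
qed

text \<open>
  If the leading coefficient \<open>b\<^sub>m\<close> lies in \<open>K y + K y\<^sup>3\<close>, then \<open>\<sigma>\<^sup>2\<close> negates it, so it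
  anticommutes with \<open>x\<^sup>2\<close>. In the condition on \<open>b\<^sup>2\<close> at the index \<open>2 m\<close>, the two terms of \<open>b\<^sup>2\<close>
  of order \<open>2 m + 2\<close> with factor \<open>b\<^sub>m\<close> therefore add up to an element without coordinates at
  \<open>1\<close> and \<open>y\<^sup>2\<close>, and the condition becomes a zero of the six-variable form: \<open>b\<^bsub>m+1\<^esub>\<close> provides
  \<open>b0, \<dots>, b3\<close>, and \<open>b\<^sub>m\<close> provides \<open>u\<close> and \<open>v\<close>. It is here that the term of \<open>A\<close> with \<open>r\<close> is
  needed.
\<close>
lemma centralizer_lead_nonzero:
  assumes b: "b \<star> B = B \<star> b" "b \<noteq> 0"
  shows "\<not> (co 0 (b $$ fls_subdegree b) = 0 \<and> co 2 (b $$ fls_subdegree b) = 0)"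
proof
  assume lead: "co 0 (b $$ fls_subdegree b) = 0 \<and> co 2 (b $$ fls_subdegree b) = 0"
  define m where "m = fls_subdegree b"
  have m: "even m" using centralizer_even_order[OF b] by (simp add: m_def)
  obtain b1 b3 where b13: "b $$ m = qd 0 b1 0 b3"
    using lead qd_co[of "b $$ m"] unfolding m_def by metis
  obtain c0 c1 c2 c3 where c: "b $$ (m + 2) = qd c0 c1 c2 c3" using qd_surj by metis
  define h where "h = K_iota powi m"
  have "h ^ 2 = 1 ^ 2" using K_iota_powi_square[of m] m by (simp add: h_def)
  then have h: "h = 1 \<or> h = - 1" by (simp only: power2_eq_iff)
  have pw_m: "pw m (qd a0 a1 a2 a3) = qd a0 (h * a1) a2 (h * a3)" for a0 a1 a2 a3
    unfolding pw_qd h_def[symmetric] using h by auto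
  have low: "b $$ i = 0" if "i < m" for i using that by (simp add: m_def)
  have lead2: "(b \<star> b) $$ (2 * m) = b $$ m * pw m (b $$ m)"
    unfolding mult_2[of m] by (rule nth_skew_mult_lead) (auto intro: low)
  have "(b \<star> b) $$ (2 * m + 2) = (\<Sum>i\<in>{m, m + 1, m + 2}. b $$ i * pw i (b $$ (2 * m + 2 - i)))"
  proof (rule nth_skew_mult)
    show "b $$ i = 0 \<or> b $$ (2 * m + 2 - i) = 0" if "i \<notin> {m, m + 1, m + 2}" for i
      using that low[of i] low[of "2 * m + 2 - i"] by force
  qed simp
  also have "\<dots> = b $$ m * pw m (b $$ (m + 2)) + b $$ (m + 1) * pw (m + 1) (b $$ (m + 1))
      + b $$ (m + 2) * pw (m + 2) (b $$ m)"
    by (simp add: algebra_simps)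
  also have "pw (m + 2) (b $$ m) = pw m (pw 2 (b $$ m))" by (simp add: pw_pw)
  finally have next2: "(b \<star> b) $$ (2 * m + 2) = b $$ m * pw m (b $$ (m + 2))
      + b $$ (m + 1) * pw (m + 1) (b $$ (m + 1)) + b $$ (m + 2) * pw m (pw 2 (b $$ m))" .
  \<comment> \<open>\<open>b m\<close> anticommutes with \<open>x\<^sup>2\<close>, so the two terms with the leading coefficient nearly cancel: what
    is left is the product of \<open>b m\<close> with an element fixed by \<open>\<sigma>\<^sup>2\<close>, which has no coordinate at \<open>1\<close> and \<open>y\<^sup>2\<close>.\<close>
  have cross: "co k (b $$ m * pw m (b $$ (m + 2))) + co k (b $$ (m + 2) * pw m (pw 2 (b $$ m))) = 0"
    if "k = 0 \<or> k = 2" for k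
    using that h unfolding b13 c pw_2_qd pw_m qd_mult by (auto simp: algebra_simps)
  let ?n = "b $$ (m + 1) * pw (m + 1) (b $$ (m + 1))"
  have split: "co k ((b \<star> b) $$ (2 * m + 2)) = co k ?n" if "k = 0 \<or> k = 2" for k
    using cross[OF that] that unfolding next2 by (auto simp: co_linear algebra_simps)
  have "4 dvd 2 * m" using m by presburger
  then have "co 0 ?n + K_s * co 2 ?n + K_const (1 / 2) * (K_r * K_s) * co 2 (b $$ m * pw m (b $$ m)) = 0"
    using orthogonal_centralizer[OF square_in_centralizer[OF b(1)], of "2 * m"]
    by (simp add: split lead2)
  moreover have "co 2 (b $$ m * pw m (b $$ m)) = h * (b1 ^ 2 + K_s * b3 ^ 2)"
    unfolding b13 pw_m qd_mult by (simp add: algebra_simps power2_eq_square)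
  moreover define e :: gaussian_rat where "e = (if h = 1 then 1 / 2 else - (1 / 2))"
  have "K_const (1 / 2) * h = K_const e"
    using h by (auto simp: e_def K_const_hom)
  moreover have "K_const (1 / 2) * (K_r * K_s) * (h * d) = (K_const (1 / 2) * h) * (K_r * K_s) * d" for d
    by (simp only: mult_ac)
  ultimately have "co 0 ?n + K_s * co 2 ?n + K_const e * (K_r * K_s) * (b1 ^ 2 + K_s * b3 ^ 2) = 0"
    by simp
  moreover have "e \<noteq> 0" using gaussian_rat_two_neq_0 by (simp add: e_def)
  moreover have "odd (m + 1)" using m by simp
  ultimately have "b1 = 0 \<and> b3 = 0"
    using odd_twisted_square by blast
  then have "b $$ m = 0" by (simp add: b13 qd_eq_0_iff)
  then show False using b(2) by (simp add: m_def)
qed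

text \<open>
  If \<open>B\<close> were quadratic over the center, some \<open>u = 2 z B + z1\<close> would have a central square, so
  \<open>[u, C] = 2 z A\<close> would anticommute with \<open>u\<close>, and so would \<open>A\<close>. Since \<open>u\<close> has even order \<open>m\<close>,
  comparing the lowest terms gives \<open>u\<^sub>m = - \<sigma>\<^sup>2(u\<^sub>m)\<close>, a forbidden leading coefficient.
\<close>
lemma not_quadratic:
  assumes z: "central z" "central z1" "central z2" "z \<noteq> 0"
  shows "z \<star> (B \<star> B) + z1 \<star> B + z2 \<noteq> 0"
proof
  assume quad: "z \<star> (B \<star> B) + z1 \<star> B + z2 = 0"
  define t where "t = z + z"
  define u where "u = t \<star> B + z1"
  note zc = central_commute[OF z(1)]
  note z1c = central_commute[OF z(2)]
  note z2c = central_commute[OF z(3)]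
  have tc: "t \<star> d = d \<star> t" for d
    by (simp only: t_def skew_distrib_left skew_distrib_right zc)
  have t0: "t \<noteq> 0"
  proof -
    obtain n where "z $$ n \<noteq> 0" using z(4) fls_nonzero_nth by blast
    moreover have "t $$ n = 2 * z $$ n" by (simp add: t_def)
    ultimately have "t $$ n \<noteq> 0" using two_neq_0 by simp
    then show ?thesis by auto
  qed
  have uB: "u \<star> B = B \<star> u"
    by (simp add: u_def skew_distrib_left skew_distrib_right z1c[of B] tc[of B] skew_assoc)
  have uC: "u \<star> C - C \<star> u = t \<star> witness"
  proof -
    have "C \<star> (t \<star> B) = t \<star> (C \<star> B)" by (metis skew_assoc tc)
    then show ?thesis
      by (simp add: u_def commutator skew_distrib_left skew_distrib_right skew_diff skew_assoc z1c[of C])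
  qed
  \<comment> \<open>Completing the square: \<open>u\<^sup>2\<close> is the discriminant of the quadratic relation, hence central.\<close>
  have uu: "u \<star> u = z1 \<star> z1 - (t \<star> z2 + t \<star> z2)"
  proof -
    have "u \<star> u = t \<star> B \<star> (t \<star> B) + t \<star> B \<star> z1 + z1 \<star> (t \<star> B) + z1 \<star> z1"
      by (simp add: u_def skew_distrib_left skew_distrib_right)
    also have "t \<star> B \<star> (t \<star> B) = t \<star> (t \<star> (B \<star> B))" by (metis skew_assoc tc)
    also have "t \<star> (B \<star> B) = z \<star> (B \<star> B) + z \<star> (B \<star> B)"
      by (simp only: t_def skew_distrib_right)
    also have "z \<star> (B \<star> B) = - (z1 \<star> B) - z2"
      using quad by (simp add: eq_diff_eq eq_neg_iff_add_eq_0 ac_simps)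
    also have "t \<star> B \<star> z1 = t \<star> (z1 \<star> B)" by (simp add: skew_assoc z1c)
    also have "z1 \<star> (t \<star> B) = t \<star> (z1 \<star> B)" by (metis skew_assoc tc)
    finally have "u \<star> u = t \<star> (- (z1 \<star> B) - z2 + (- (z1 \<star> B) - z2)) + t \<star> (z1 \<star> B) +
        t \<star> (z1 \<star> B) + z1 \<star> z1" .
    then show ?thesis
      by (simp only: skew_distrib_left skew_diff skew_minus) (simp add: algebra_simps)
  qed
  have "u \<star> u \<star> C = C \<star> (u \<star> u)"
  proof -
    have "z1 \<star> z1 \<star> C = C \<star> (z1 \<star> z1)" by (metis skew_assoc z1c)
    moreover have "t \<star> z2 \<star> C = C \<star> (t \<star> z2)" by (metis skew_assoc z2c tc)
    ultimately show ?thesis unfolding uu by (simp only: skew_diff skew_distrib_left skew_distrib_right)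
  qed
  then have "u \<star> (t \<star> witness) + t \<star> witness \<star> u = 0"
    unfolding uC[symmetric] by (simp add: skew_diff skew_assoc)
  moreover have "u \<star> (t \<star> witness) = t \<star> (u \<star> witness)" by (metis skew_assoc tc)
  ultimately have "t \<star> (u \<star> witness + witness \<star> u) = 0"
    by (simp add: skew_distrib_left skew_assoc)
  then have anti: "u \<star> witness + witness \<star> u = 0"
    using t0 by (simp add: skew_mult_eq_0_iff)
  have "t \<star> witness \<noteq> 0" using t0 witness_neq_0 by (simp add: skew_mult_eq_0_iff)
  then have u0: "u \<noteq> 0" unfolding uC[symmetric] by auto
  define m where "m = fls_subdegree u"
  have m: "even m" using centralizer_even_order[OF uB u0] by (simp add: m_def)
  obtain b0 b1 b2 b3 where b: "u $$ m = qd b0 b1 b2 b3" using qd_surj by metis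
  have um2: "u $$ (m - 2) = 0" by (simp add: m_def)
  have "(u \<star> witness + witness \<star> u) $$ (m - 2) =
      u $$ m * pw m (1 + y ^ 2) + (1 + y ^ 2) * pw 2 (u $$ m)"
    by (simp add: nth_mult_witness nth_witness_mult um2)
  also have "pw m (1 + y ^ 2) = 1 + y ^ 2"
    using K_iota_powi_square[of m] m by (simp add: one_plus_y2 pw_qd)
  also have "u $$ m * (1 + y ^ 2) + (1 + y ^ 2) * pw 2 (u $$ m) = (1 + y ^ 2) * (u $$ m + pw 2 (u $$ m))"
    by (simp add: algebra_simps)
  finally have "(1 + y ^ 2) * (u $$ m + pw 2 (u $$ m)) = 0" using anti by simp
  moreover have "1 + y ^ 2 \<noteq> 0" by (simp add: one_plus_y2 qd_eq_0_iff)
  ultimately have "qd (b0 + b0) 0 (b2 + b2) 0 = 0"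
    by (simp add: b pw_2_qd qd_add)
  then have "b0 = 0" "b2 = 0" using K_two_neq_0 by (auto simp: qd_eq_0_iff simp flip: mult_2)
  then show False using centralizer_lead_nonzero[OF uB u0] by (simp flip: m_def add: b)
qed

lemma not_central: "\<not> central B"
  using commutator central_commute[of B C] witness_neq_0 by auto

text \<open>
  Gaussian elimination with two functionals in the span of \<open>1, B, B\<^sup>2\<close> over the center: first
  the component at \<open>1\<close> is removed from \<open>B\<close> and \<open>B\<^sup>2\<close>, then the other component from a
  combination of the results, which does not vanish since \<open>B\<close> is not quadratic. Elements of
  this span commute with the whole centralizer of \<open>B\<close>, in particular with each other.
\<close>
lemma double_centralizer_elimination:
  assumes l: "l \<in> {0, 2}"
  obtains w where "w \<noteq> 0" "component 0 0 w = 0" "component l 2 w = 0"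
    "\<And>b. b \<star> B = B \<star> b \<Longrightarrow> b \<star> w = w \<star> b"
proof -
  let ?f = "component 0 0" and ?g = "component l 2"
  have cf: "central (?f d)" and cg: "central (?g d)" for d by (simp_all add: central_component)
  note comm = central_commute[OF cf] central_commute[OF cg]
  define u v where "u = B - ?f B" and "v = B \<star> B - ?f (B \<star> B)"
  have fu: "?f u = 0" and fv: "?f v = 0"
    by (simp_all add: u_def v_def component_diff component_central(1) cf)
  have u0: "u \<noteq> 0" using not_central cf[of B] by (auto simp: u_def)
  have bu: "b \<star> u = u \<star> b" and bv: "b \<star> v = v \<star> b" if "b \<star> B = B \<star> b" for b
  proof -
    show "b \<star> u = u \<star> b" using that by (simp add: u_def skew_diff comm(1))
    have "b \<star> (B \<star> B) = B \<star> B \<star> b" by (metis that skew_assoc)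
    then show "b \<star> v = v \<star> b" by (simp add: v_def skew_diff comm(1))
  qed
  show ?thesis
  proof (cases "?g u = 0")
    case True
    show ?thesis by (rule that[OF u0 fu True bu])
  next
    case gu: False
    define w where "w = ?g v \<star> u - ?g u \<star> v"
    have "?f w = 0"
      by (simp add: w_def component_diff component_central_mult cg fu fv)
    moreover have "?g w = 0"
      by (simp add: w_def component_diff component_central_mult cg comm(2)[of v "?g u"])
    moreover have "b \<star> w = w \<star> b" if "b \<star> B = B \<star> b" for b
    proof -
      have "b \<star> (?g v \<star> u) = ?g v \<star> u \<star> b" by (metis skew_assoc bu[OF that] comm(2))
      moreover have "b \<star> (?g u \<star> v) = ?g u \<star> v \<star> b" by (metis skew_assoc bv[OF that] comm(2))
      ultimately show ?thesis by (simp add: w_def skew_diff)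
    qed
    moreover have "w \<noteq> 0"
    proof
      assume w0: "w = 0"
      let ?z2 = "?g v \<star> ?f B - ?g u \<star> ?f (B \<star> B)"
      have z2: "central ?z2"
      proof -
        have "?z2 = ?f (?g v \<star> B - ?g u \<star> (B \<star> B))"
          by (simp add: component_diff component_central_mult cg)
        then show ?thesis by (metis cf)
      qed
      have "central (- ?g v)" using cg[of v] by (auto simp: central_def simp flip: emb_minus)
      then have "?g u \<star> (B \<star> B) + (- ?g v) \<star> B + ?z2 \<noteq> 0"
        by (intro not_quadratic cg z2 gu)
      moreover have "?g u \<star> (B \<star> B) + (- ?g v) \<star> B + ?z2 = - w"
        by (simp add: w_def u_def v_def skew_diff skew_minus)
      ultimately show False using w0 by simp
    qed
    ultimately show ?thesis by (intro that)
  qed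
qed

text \<open>
  The components missing in \<open>b\<close> exclude order 2 modulo 4, those missing in \<open>c\<close> exclude order 0
  modulo 4. The leading coefficients \<open>\<beta>\<close> of \<open>b\<close> and \<open>\<gamma>\<close> of \<open>c\<close> then satisfy \<open>\<beta> \<gamma> = \<gamma> \<sigma>\<^sup>2(\<beta>)\<close>,
  so \<open>\<beta> \<in> K y\<^sup>2\<close>. Writing \<open>\<gamma>\<^sub>k\<close> for the coordinates of \<open>\<gamma>\<close>, the conditions for \<open>c\<close> and \<open>bc\<close> read
  \<open>\<gamma>\<^sub>0 + s \<gamma>\<^sub>2 = 0\<close> and \<open>\<gamma>\<^sub>2 + \<gamma>\<^sub>0 = 0\<close>, hence \<open>\<gamma>\<^sub>0 = \<gamma>\<^sub>2 = 0\<close>, which is forbidden.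
\<close>
lemma commutator_impossible: False
proof -
  obtain b where b0: "b \<noteq> 0" and fb: "component 0 0 b = 0" and gb: "component 2 2 b = 0"
    and bc: "\<And>d. d \<star> B = B \<star> d \<Longrightarrow> d \<star> b = b \<star> d"
    using double_centralizer_elimination[of 2] by auto
  obtain c where c0: "c \<noteq> 0" and fc: "component 0 0 c = 0" and gc: "component 0 2 c = 0"
    and cc: "\<And>d. d \<star> B = B \<star> d \<Longrightarrow> d \<star> c = c \<star> d"
    using double_centralizer_elimination[of 0] by auto
  have bB: "b \<star> B = B \<star> b" and cB: "c \<star> B = B \<star> c" using bc[of B] cc[of B] by auto
  have comp: "co k (d $$ (n + l)) = 0" if "component l k d = 0" "4 dvd n" "k < 4" for l k d n
    using nth_component[OF that(3), of l d n] that by simp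
  define m n where "m = fls_subdegree b" and "n = fls_subdegree c"
  have even: "even m" "even n"
    using centralizer_even_order bB cB b0 c0 by (simp_all add: m_def n_def)
  have m4: "4 dvd m"
  proof (rule ccontr)
    assume "\<not> 4 dvd m"
    then have m2: "4 dvd m - 2" using even by presburger
    have "co 2 (b $$ m) = 0" using comp[OF gb m2] by simp
    moreover have "b $$ (m - 2) = 0" by (simp add: m_def)
    ultimately have "co 0 (b $$ m) = 0"
      using orthogonal_centralizer[OF bB m2] by (simp add: co_zero)
    with \<open>co 2 (b $$ m) = 0\<close> show False using centralizer_lead_nonzero[OF bB b0] by (simp add: m_def)
  qed
  have n4: "\<not> 4 dvd n"
  proof
    assume n4: "4 dvd n"
    show False
      using centralizer_lead_nonzero[OF cB c0] comp[OF fc n4] comp[OF gc n4] by (simp add: n_def)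
  qed
  then have n2: "4 dvd n - 2" using even by presburger
  obtain b0' b1 b2 b3 where b: "b $$ m = qd b0' b1 b2 b3" using qd_surj by metis
  obtain c0' c1 c2 c3 where c: "c $$ n = qd c0' c1 c2 c3" using qd_surj by metis
  have lead: "b $$ m \<noteq> 0" "c $$ n \<noteq> 0" using b0 c0 by (simp_all add: m_def n_def)
  have bc_nth: "(b \<star> c) $$ (m + n) = b $$ m * c $$ n"
  proof -
    have "(b \<star> c) $$ (m + n) = b $$ m * pw m (c $$ n)"
      by (rule nth_skew_mult_lead) (auto simp: m_def n_def)
    then show ?thesis by (simp add: pw_4 m4)
  qed
  have cb_nth: "(c \<star> b) $$ (m + n) = c $$ n * pw 2 (b $$ m)"
  proof -
    have "(c \<star> b) $$ (n + m) = c $$ n * pw n (b $$ m)"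
      by (rule nth_skew_mult_lead) (auto simp: m_def n_def)
    then show ?thesis by (simp add: pw_mod_4[OF n2] add.commute)
  qed
  have "b \<star> c = c \<star> b" using cc[OF bB] .
  then have "c $$ n * b $$ m = c $$ n * pw 2 (b $$ m)"
    using bc_nth cb_nth by (metis mult.commute)
  then have "qd b0' b1 b2 b3 = qd b0' (- b1) b2 (- b3)" using lead by (simp add: b pw_2_qd)
  then have "b1 = 0" "b3 = 0" using K_neq_minus by (auto simp: qd_eq_iff)
  moreover have "b0' = 0" using comp[OF fb m4] by (simp add: b)
  ultimately have b': "b $$ m = qd 0 0 b2 0" using b by simp
  then have b2: "b2 \<noteq> 0" using lead by (auto simp: qd_eq_0_iff)
  have "c $$ (n - 2) = 0" by (simp add: n_def)
  then have e1: "c0' + K_s * c2 = 0"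
    using orthogonal_centralizer[OF cB n2] by (simp add: c co_zero)
  have "b \<star> c \<star> B = B \<star> (b \<star> c)" by (metis skew_assoc bB cB)
  moreover have "4 dvd m + n - 2" using m4 n2 by presburger
  moreover have "(b \<star> c) $$ (m + n - 2) = 0"
    by (rule nth_skew_mult_eq_0[of m _ n]) (auto simp: m_def n_def)
  ultimately have "K_s * (b2 * c2) + K_s * (b2 * c0') = 0"
    using orthogonal_centralizer[of "b \<star> c" "m + n - 2"]
    by (simp add: bc_nth b' c qd_mult co_zero)
  then have "K_s * b2 * (c2 + c0') = 0" by (simp add: algebra_simps)
  then have "c2 = - c0'" using b2 K_s_neq_0 by (simp add: add_eq_0_iff2)
  with e1 have "(1 - K_s) * c0' = 0" by (simp add: algebra_simps)
  then have "c0' = 0" "c2 = 0" using K_s_neq_1 \<open>c2 = - c0'\<close> by auto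
  then show False using centralizer_lead_nonzero[OF cB c0] by (simp add: c flip: n_def)
qed

end

end

section \<open>Traces of commutators\<close>

lemma (in abelian_monoid) finsum_swap:
  assumes "finite A" "finite B" "\<And>a b. a \<in> A \<Longrightarrow> b \<in> B \<Longrightarrow> f a b \<in> carrier G"
  shows "(\<Oplus>a\<in>A. \<Oplus>b\<in>B. f a b) = (\<Oplus>b\<in>B. \<Oplus>a\<in>A. f a b)"
  using assms(1,3)
proof (induction A rule: finite_induct)
  case empty
  then show ?case by simp
next
  case (insert a A)
  have "(\<Oplus>a\<in>insert a A. \<Oplus>b\<in>B. f a b) = (\<Oplus>b\<in>B. f a b) \<oplus> (\<Oplus>b\<in>B. \<Oplus>a\<in>A. f a b)"
    using insert by (subst finsum_insert) (auto intro!: finsum_closed)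
  also have "\<dots> = (\<Oplus>b\<in>B. f a b \<oplus> (\<Oplus>a\<in>A. f a b))"
    using insert by (intro finsum_addf[symmetric]) (auto intro!: finsum_closed)
  also have "\<dots> = (\<Oplus>b\<in>B. \<Oplus>a\<in>insert a A. f a b)"
    using insert by (intro finsum_cong') (auto simp: finsum_insert intro!: finsum_closed)
  finally show ?case .
qed

lemma (in cring) matrix_trace_mult_commute:
  assumes "M \<in> carrier (matrix_ring R n)" "N \<in> carrier (matrix_ring R n)"
  shows "matrix_trace R n (M \<otimes>\<^bsub>matrix_ring R n\<^esub> N) = matrix_trace R n (N \<otimes>\<^bsub>matrix_ring R n\<^esub> M)"
proof -
  have in_R: "M (i, j) \<in> carrier R" "N (i, j) \<in> carrier R" if "i < n" "j < n" for i j
    using that assms by (auto simp: matrix_ring_def)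
  have "matrix_trace R n (M \<otimes>\<^bsub>matrix_ring R n\<^esub> N) = (\<Oplus>i\<in>{..<n}. \<Oplus>k\<in>{..<n}. M (i, k) \<otimes> N (k, i))"
    unfolding matrix_trace_def
    by (rule finsum_cong') (auto simp: matrix_ring_def in_R intro!: finsum_closed)
  also have "\<dots> = (\<Oplus>k\<in>{..<n}. \<Oplus>i\<in>{..<n}. M (i, k) \<otimes> N (k, i))"
    by (rule finsum_swap) (auto simp: in_R)
  also have "\<dots> = (\<Oplus>k\<in>{..<n}. \<Oplus>i\<in>{..<n}. N (k, i) \<otimes> M (i, k))"
    by (intro finsum_cong') (auto simp: in_R m_comm intro!: finsum_closed)
  also have "\<dots> = matrix_trace R n (N \<otimes>\<^bsub>matrix_ring R n\<^esub> M)"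
    unfolding matrix_trace_def
    by (rule finsum_cong'[symmetric]) (auto simp: matrix_ring_def in_R intro!: finsum_closed)
  finally show ?thesis .
qed

lemma (in cring) matrix_trace_add:
  assumes "M \<in> carrier (matrix_ring R n)" "N \<in> carrier (matrix_ring R n)"
  shows "matrix_trace R n (M \<oplus>\<^bsub>matrix_ring R n\<^esub> N) = matrix_trace R n M \<oplus> matrix_trace R n N"
proof -
  have in_R: "M (i, j) \<in> carrier R" "N (i, j) \<in> carrier R" if "i < n" "j < n" for i j
    using that assms by (auto simp: matrix_ring_def)
  have "matrix_trace R n (M \<oplus>\<^bsub>matrix_ring R n\<^esub> N) = (\<Oplus>i\<in>{..<n}. M (i, i) \<oplus> N (i, i))"
    unfolding matrix_trace_def
    by (rule finsum_cong') (auto simp: matrix_ring_def in_R)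
  also have "\<dots> = matrix_trace R n M \<oplus> matrix_trace R n N"
    unfolding matrix_trace_def by (rule finsum_addf) (auto simp: in_R)
  finally show ?thesis .
qed

lemma (in cring) matrix_trace_closed:
  "M \<in> carrier (matrix_ring R n) \<Longrightarrow> matrix_trace R n M \<in> carrier R"
  unfolding matrix_trace_def by (rule finsum_closed) (auto simp: matrix_ring_def)

text \<open>
  The commutator relations are written without subtraction, so that the homomorphism property
  of \<open>\<phi>\<close> applies directly. As the trace is zero for every splitting, zero is the only
  candidate for the reduced trace.
\<close>
lemma (in ring) splitting_trace_sum_of_commutators:
  assumes split: "splitting R L n \<phi>"
    and D: "a \<in> carrier R" "b \<in> carrier R" "a' \<in> carrier R" "b' \<in> carrier R"
      "c \<in> carrier R" "c' \<in> carrier R"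
    and c: "c \<oplus> b \<otimes> a = a \<otimes> b" and c': "c' \<oplus> b' \<otimes> a' = a' \<otimes> b'"
  shows "matrix_trace (R\<lparr>carrier := L\<rparr>) n (\<phi> (c \<oplus> c')) = \<zero>"
proof -
  let ?L = "R\<lparr>carrier := L\<rparr>"
  let ?M = "matrix_ring ?L n"
  let ?t = "\<lambda>d. matrix_trace ?L n (\<phi> d)"
  have L: "subfield L R" and \<phi>: "\<phi> \<in> ring_hom R ?M"
    using split by (auto simp: splitting_def Let_def)
  have "cring ?L"
    using subcring_iff[OF subfieldE(3)[OF L]] subfieldE(2)[OF L] by simp
  then interpret L: cring ?L .
  have M: "\<phi> d \<in> carrier ?M" if "d \<in> carrier R" for d
    using ring_hom_closed[OF \<phi> that] .
  have add: "?t (d \<oplus> e) = ?t d \<oplus> ?t e" if "d \<in> carrier R" "e \<in> carrier R" for d e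
    using L.matrix_trace_add[OF M[OF that(1)] M[OF that(2)]] that
    by (simp add: ring_hom_add[OF \<phi>])
  have commute: "?t (d \<otimes> e) = ?t (e \<otimes> d)" if "d \<in> carrier R" "e \<in> carrier R" for d e
    using L.matrix_trace_mult_commute[OF M[OF that(1)] M[OF that(2)]] that
    by (simp add: ring_hom_mult[OF \<phi>])
  have vanish: "?t z = \<zero>" if "d \<in> carrier R" "e \<in> carrier R" "z \<in> carrier R" "z \<oplus> e \<otimes> d = d \<otimes> e" for z d e
  proof -
    have "?t z \<oplus>\<^bsub>?L\<^esub> ?t (e \<otimes> d) = ?t (e \<otimes> d)"
      using add[of z "e \<otimes> d"] commute[of d e] that by simp
    moreover have "?t z \<in> carrier ?L" "?t (e \<otimes> d) \<in> carrier ?L"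
      using L.matrix_trace_closed[OF M[of z]] L.matrix_trace_closed[OF M[of "e \<otimes> d"]] that by auto
    ultimately show ?thesis using L.add.r_cancel_one' by fastforce
  qed
  show ?thesis
    using add[of c c'] vanish[OF D(1,2,5) c] vanish[OF D(3,4,6) c'] D L.zero_closed by simp
qed

section \<open>A splitting over \<open>K((x))\<close>\<close>

context quartic_extension
begin

text \<open>
  The image of \<open>lift\<close> is the subfield \<open>K((x))\<close> of \<open>D\<close>: as \<open>\<sigma>\<close> fixes \<open>K\<close>, skew multiplication
  restricts to the commutative multiplication of Laurent series, so inverses can be taken in
  \<open>K_field fls\<close>.
\<close>
definition lift :: "K_field fls \<Rightarrow> 'f fls" where
  "lift g = Abs_fls (\<lambda>n. emb (g $$ n))"

lemma nth_lift [simp]: "lift g $$ n = emb (g $$ n)"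
  unfolding lift_def by (rule nth_Abs_fls_lower_bound[of "fls_subdegree g"]) simp

lemma lift_add: "lift (g + h) = lift g + lift h"
  by (rule fls_eqI) (simp add: emb_add)

lemma lift_minus: "lift (- g) = - lift g"
  by (rule fls_eqI) (simp add: emb_minus)

lemma lift_zero: "lift 0 = 0"
  by (rule fls_eqI) simp

lemma lift_mult: "lift (g * h) = lift g \<star> lift h"
proof (rule fls_eqI)
  fix n
  have "(lift g \<star> lift h) $$ n = (\<Sum>i=fls_subdegree g..n - fls_subdegree h.
      lift g $$ i * pw i (lift h $$ (n - i)))"
    by (rule nth_skew_mult) auto
  then show "lift (g * h) $$ n = (lift g \<star> lift h) $$ n"
    by (simp add: fls_times_nth(2) emb_sum emb_mult)
qed

lemma lift_one: "lift 1 = skew_monom 1 0"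
  by (rule fls_eqI) (auto simp: fls_nth_skew_monom)

lemma lift_eq_iff: "lift g = lift h \<longleftrightarrow> g = h"
  by (auto simp: fls_eq_iff)

text \<open>
  The coordinates of an element of \<open>D\<close> with respect to the basis \<open>1, y, y\<^sup>2, y\<^sup>3\<close> of \<open>D\<close> as a
  right vector space over \<open>K((x))\<close>.
\<close>
definition coord :: "nat \<Rightarrow> 'f fls \<Rightarrow> K_field fls" where
  "coord k d = Abs_fls (\<lambda>n. co k (d $$ n))"

lemma nth_coord: "k < 4 \<Longrightarrow> coord k d $$ n = co k (d $$ n)"
  unfolding coord_def by (rule nth_Abs_fls_lower_bound[of "fls_subdegree d"]) (simp add: co_zero)

lemma coord_add: "k < 4 \<Longrightarrow> coord k (d + e) = coord k d + coord k e"
  by (rule fls_eqI) (simp add: nth_coord co_linear)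

lemma coord_sum: "k < 4 \<Longrightarrow> coord k (\<Sum>i\<in>I. g i) = (\<Sum>i\<in>I. coord k (g i))"
  by (rule fls_eqI) (simp add: nth_coord fls_nth_sum co_sum)

lemma coord_mult_lift:
  assumes k: "k < 4"
  shows "coord k (d \<star> lift g) = coord k d * g"
proof (rule fls_eqI)
  fix n
  let ?I = "{min (fls_subdegree d) (fls_subdegree (coord k d))..n - fls_subdegree g}"
  have "(d \<star> lift g) $$ n = (\<Sum>i\<in>?I. emb (g $$ (n - i)) * d $$ i)"
    by (subst nth_skew_mult[of ?I]) (auto simp: mult.commute)
  then have "coord k (d \<star> lift g) $$ n = (\<Sum>i\<in>?I. g $$ (n - i) * co k (d $$ i))"
    by (simp add: nth_coord k co_sum co_linear)
  also have "\<dots> = (\<Sum>i\<in>{fls_subdegree (coord k d)..n - fls_subdegree g}. g $$ (n - i) * coord k d $$ i)"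
    by (rule sum.mono_neutral_cong_right) (auto simp: nth_coord[symmetric] k)
  also have "\<dots> = (coord k d * g) $$ n"
    by (simp add: fls_times_nth(2) mult.commute[of "g $$ _"])
  finally show "coord k (d \<star> lift g) $$ n = (coord k d * g) $$ n" .
qed

abbreviation ym :: "nat \<Rightarrow> 'f fls" where "ym j \<equiv> skew_monom (y ^ j) 0"

lemma co_y_power:
  assumes "e < 4" "k < 4"
  shows "co k (y ^ e) = (if k = e then 1 else 0)"
proof -
  have "y ^ 0 = qd 1 0 0 0" "y ^ 1 = qd 0 1 0 0" "y ^ 2 = qd 0 0 1 0" "y ^ 3 = qd 0 0 0 1"
    by (simp_all add: qd_def)
  note p = this
  have "e = 0 \<or> e = 1 \<or> e = 2 \<or> e = 3" "k = 0 \<or> k = 1 \<or> k = 2 \<or> k = 3"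
    using assms by auto
  then show ?thesis by (elim disjE) (simp_all only: p co_qd_simps, simp_all)
qed

lemma sum_ym_coord: "(\<Sum>k<4. ym k \<star> lift (coord k d)) = d"
proof (rule fls_eqI)
  fix n
  have "(\<Sum>k<4. ym k \<star> lift (coord k d)) $$ n = (\<Sum>k<4. y ^ k * emb (co k (d $$ n)))"
    by (simp add: fls_nth_sum nth_monom_mult nth_coord)
  also have "\<dots> = qd (co 0 (d $$ n)) (co 1 (d $$ n)) (co 2 (d $$ n)) (co 3 (d $$ n))"
    by (simp add: qd_def eval_nat_numeral mult_ac)
  finally show "(\<Sum>k<4. ym k \<star> lift (coord k d)) $$ n = d $$ n" by (simp only: qd_co)
qed

lemma coord_ym: "j < 4 \<Longrightarrow> k < 4 \<Longrightarrow> coord k (ym j) = (if k = j then 1 else 0)"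
  by (rule fls_eqI) (simp add: nth_coord fls_nth_skew_monom co_y_power co_zero)

abbreviation "skewD \<equiv> skew_laurent \<sigma>"
abbreviation "Kx \<equiv> range lift"
abbreviation "Kx_ring \<equiv> skew_laurent \<sigma>\<lparr>carrier := range lift\<rparr>"

lemma D_simps: "carrier skewD = UNIV" "B \<otimes>\<^bsub>skewD\<^esub> C = B \<star> C" "B \<oplus>\<^bsub>skewD\<^esub> C = B + C" "\<one>\<^bsub>skewD\<^esub> = skew_monom 1 0"
  "\<zero>\<^bsub>skewD\<^esub> = 0"
  by (simp_all add: skew_laurent_def)

lemma subfield_Kx: "subfield Kx skewD"
proof -
  interpret SR: ring skewD by (rule ring_skew_laurent)
  have minus: "\<ominus>\<^bsub>skewD\<^esub> h = - h" for h
    by (rule SR.minus_equality) (auto simp: D_simps)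
  have sub: "subring Kx skewD"
    by (rule SR.subringI)
      (auto simp: D_simps minus simp flip: lift_add lift_mult lift_minus lift_one)
  have comm: "lift g \<star> lift h = lift h \<star> lift g" for g h
    by (simp add: mult.commute flip: lift_mult)
  show ?thesis
  proof (rule SR.subfieldI)
    show "subcring Kx skewD"
      by (rule SR.subcringI[OF sub]) (auto simp: D_simps comm)
    show "Units (skewD\<lparr>carrier := Kx\<rparr>) = Kx - {\<zero>\<^bsub>skewD\<^esub>}"
    proof (intro equalityI subsetI)
      fix u assume "u \<in> Units (skewD\<lparr>carrier := Kx\<rparr>)"
      then obtain v where "u \<in> Kx" "v \<star> u = skew_monom 1 0"
        by (auto simp: Units_def D_simps)
      moreover have "skew_monom 1 0 \<noteq> (0 :: 'f fls)"
        by (metis lift_one lift_zero lift_eq_iff zero_neq_one)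
      ultimately show "u \<in> Kx - {\<zero>\<^bsub>skewD\<^esub>}" by (auto simp: D_simps)
    next
      fix u assume "u \<in> Kx - {\<zero>\<^bsub>skewD\<^esub>}"
      then obtain g where g: "u = lift g" "g \<noteq> 0" using lift_zero by (force simp: D_simps)
      then have "lift (inverse g) \<star> u = skew_monom 1 0" "u \<star> lift (inverse g) = skew_monom 1 0"
        by (simp_all flip: lift_mult lift_one)
      then show "u \<in> Units (skewD\<lparr>carrier := Kx\<rparr>)"
        using g by (auto simp: Units_def D_simps)
    qed
  qed
qed

lemma cring_Kx: "cring Kx_ring"
proof -
  interpret SR: ring skewD by (rule ring_skew_laurent)
  show ?thesis
    using SR.subcring_iff[OF subfieldE(3)[OF subfield_Kx]] subfieldE(2)[OF subfield_Kx] by simp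
qed

text \<open>
  An element that commutes with \<open>x\<close> has coefficients fixed by \<open>\<sigma>\<close>, that is, in \<open>K\<close>.
\<close>
lemma center_subset_Kx: "ring_center skewD \<subseteq> Kx"
proof
  fix z assume "z \<in> ring_center skewD"
  then have z: "z \<star> skew_monom 1 1 = skew_monom 1 1 \<star> z"
    by (simp add: ring_center_def D_simps)
  have "co k (z $$ n) = 0" if "k = 1 \<or> k = 2 \<or> k = 3" for k n
  proof -
    obtain a0 a1 a2 a3 where a: "z $$ n = qd a0 a1 a2 a3" using qd_surj by metis
    have "\<sigma> (z $$ n) = z $$ n"
      using arg_cong[OF z, of "\<lambda>d. d $$ (n + 1)"]
      by (simp add: nth_monom_mult nth_mult_monom int_funpow_1)
    then have "(K_iota - 1) * a1 = 0" "a2 = - a2" "(K_iota + 1) * a3 = 0"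
      by (auto simp: a \<sigma>_qd qd_eq_iff algebra_simps add_eq_0_iff2)
    moreover have "K_iota - 1 \<noteq> 0" "K_iota + 1 \<noteq> 0"
      using K_iota_neq by (simp_all add: add_eq_0_iff2)
    ultimately have "a1 = 0" "a2 = 0" "a3 = 0" using K_neq_minus by auto
    then show ?thesis using that by (auto simp: a)
  qed
  then have "z $$ n = emb (co 0 (z $$ n))" for n
    using qd_co[of "z $$ n"] by (simp add: qd_def)
  then have "z = lift (coord 0 z)"
    by (intro fls_eqI) (simp add: nth_coord)
  then show "z \<in> Kx" by blast
qed

definition mat :: "(nat \<Rightarrow> nat \<Rightarrow> K_field fls) \<Rightarrow> nat \<times> nat \<Rightarrow> 'f fls" where
  "mat E = (\<lambda>(i, j) \<in> {..<4} \<times> {..<4}. lift (E i j))"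

lemma mat_cong: "(\<And>i j. i < 4 \<Longrightarrow> j < 4 \<Longrightarrow> E i j = E' i j) \<Longrightarrow> mat E = mat E'"
  by (auto simp: mat_def fun_eq_iff restrict_def)

lemma mat_surj:
  assumes "N \<in> carrier (matrix_ring Kx_ring 4)"
  obtains E where "N = mat E"
proof -
  have N: "N \<in> {..<4} \<times> {..<4} \<rightarrow>\<^sub>E Kx" using assms by (simp add: matrix_ring_def)
  define E where "E = (\<lambda>i j. SOME g. N (i, j) = lift g)"
  have E: "N (i, j) = lift (E i j)" if "i < 4" "j < 4" for i j
    unfolding E_def by (rule someI_ex) (use PiE_mem[OF N, of "(i, j)"] that in auto)
  have "N = mat E"
  proof
    fix p :: "nat \<times> nat"
    obtain i j where p: "p = (i, j)" by force
    show "N p = mat E p"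
    proof (cases "p \<in> {..<4} \<times> {..<4}")
      case True
      then show ?thesis using E by (simp add: mat_def p)
    next
      case False
      then show ?thesis using PiE_arb[OF N False] by (simp add: mat_def)
    qed
  qed
  then show ?thesis using that by blast
qed

lemma finsum_Kx:
  assumes "finite I"
  shows "(\<Oplus>\<^bsub>Kx_ring\<^esub>k\<in>I. lift (g k)) = lift (\<Sum>k\<in>I. g k)"
proof -
  interpret cring Kx_ring by (rule cring_Kx)
  show ?thesis using assms
    by (induction I rule: finite_induct) (auto simp: lift_add lift_zero D_simps)
qed

lemma mat_carrier: "mat E \<in> carrier (matrix_ring Kx_ring 4)"
  by (auto simp: mat_def matrix_ring_def)

lemma mat_add: "mat E \<oplus>\<^bsub>matrix_ring Kx_ring 4\<^esub> mat E' = mat (\<lambda>i j. E i j + E' i j)"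
  by (auto simp: mat_def matrix_ring_def D_simps lift_add fun_eq_iff restrict_def)

lemma mat_mult: "mat E \<otimes>\<^bsub>matrix_ring Kx_ring 4\<^esub> mat E' = mat (\<lambda>i j. \<Sum>k<4. E i k * E' k j)"
proof -
  have "(\<Oplus>\<^bsub>Kx_ring\<^esub>k\<in>{..<4}. mat E (i, k) \<otimes>\<^bsub>Kx_ring\<^esub> mat E' (k, j)) = lift (\<Sum>k<4. E i k * E' k j)"
    if "i < 4" "j < 4" for i j
  proof -
    interpret cring Kx_ring by (rule cring_Kx)
    have "(\<Oplus>\<^bsub>Kx_ring\<^esub>k\<in>{..<4}. mat E (i, k) \<otimes>\<^bsub>Kx_ring\<^esub> mat E' (k, j)) =
        (\<Oplus>\<^bsub>Kx_ring\<^esub>k\<in>{..<4}. lift (E i k * E' k j))"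
      by (rule finsum_cong') (use that in \<open>auto simp: mat_def D_simps simp flip: lift_mult\<close>)
    then show ?thesis by (simp add: finsum_Kx)
  qed
  then show ?thesis
    by (auto simp: matrix_ring_def mat_def[of "\<lambda>i j. \<Sum>k<4. E i k * E' k j"] fun_eq_iff restrict_def)
qed

lemma mat_scalar: "scalar_matrix Kx_ring 4 (lift c) = mat (\<lambda>i j. if i = j then c else 0)"
  by (auto simp: scalar_matrix_def mat_def D_simps lift_zero fun_eq_iff restrict_def)

lemma mat_one: "\<one>\<^bsub>matrix_ring Kx_ring 4\<^esub> = mat (\<lambda>i j. if i = j then 1 else 0)"
  by (simp add: matrix_ring_def D_simps flip: mat_scalar lift_one)

lemma mat_zero: "\<zero>\<^bsub>matrix_ring Kx_ring 4\<^esub> = mat (\<lambda>i j. 0)"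
proof -
  have "\<zero>\<^bsub>matrix_ring Kx_ring 4\<^esub> = scalar_matrix Kx_ring 4 (lift 0)"
    by (simp add: matrix_ring_def D_simps lift_zero)
  then show ?thesis by (simp add: mat_scalar)
qed

lemma abelian_monoid_matrix_ring: "abelian_monoid (matrix_ring Kx_ring 4)"
proof (rule abelian_monoidI)
  fix M N P assume "M \<in> carrier (matrix_ring Kx_ring 4)" "N \<in> carrier (matrix_ring Kx_ring 4)"
    "P \<in> carrier (matrix_ring Kx_ring 4)"
  then show "M \<oplus>\<^bsub>matrix_ring Kx_ring 4\<^esub> N \<oplus>\<^bsub>matrix_ring Kx_ring 4\<^esub> P =
      M \<oplus>\<^bsub>matrix_ring Kx_ring 4\<^esub> (N \<oplus>\<^bsub>matrix_ring Kx_ring 4\<^esub> P)"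
    by (elim mat_surj) (simp add: mat_add add.assoc)
next
  fix M N assume "M \<in> carrier (matrix_ring Kx_ring 4)" "N \<in> carrier (matrix_ring Kx_ring 4)"
  then show "M \<oplus>\<^bsub>matrix_ring Kx_ring 4\<^esub> N \<in> carrier (matrix_ring Kx_ring 4)"
    "M \<oplus>\<^bsub>matrix_ring Kx_ring 4\<^esub> N = N \<oplus>\<^bsub>matrix_ring Kx_ring 4\<^esub> M"
    by (elim mat_surj; simp add: mat_add mat_carrier add.commute)+
next
  fix M assume "M \<in> carrier (matrix_ring Kx_ring 4)"
  then show "\<zero>\<^bsub>matrix_ring Kx_ring 4\<^esub> \<oplus>\<^bsub>matrix_ring Kx_ring 4\<^esub> M = M"
    by (elim mat_surj) (simp add: mat_add mat_zero)
qed (simp add: mat_zero mat_carrier)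

lemma finsum_mat:
  assumes "finite I"
  shows "(\<Oplus>\<^bsub>matrix_ring Kx_ring 4\<^esub>t\<in>I. mat (E t)) = mat (\<lambda>i j. \<Sum>t\<in>I. E t i j)"
proof -
  interpret abelian_monoid "matrix_ring Kx_ring 4" by (rule abelian_monoid_matrix_ring)
  show ?thesis using assms
    by (induction I rule: finite_induct) (auto simp: mat_zero mat_add mat_carrier)
qed

text \<open>
  The matrix of left multiplication by \<open>d\<close> on \<open>D\<close> as a right vector space over \<open>K((x))\<close>.
\<close>
definition rep :: "'f fls \<Rightarrow> nat \<times> nat \<Rightarrow> 'f fls" where
  "rep d = mat (\<lambda>i j. coord i (d \<star> ym j))"

lemma rep_hom: "rep \<in> ring_hom skewD (matrix_ring Kx_ring 4)"
proof (rule ring_hom_memI)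
  fix d e
  show "rep (d \<oplus>\<^bsub>skewD\<^esub> e) = rep d \<oplus>\<^bsub>matrix_ring Kx_ring 4\<^esub> rep e"
    unfolding rep_def mat_add by (rule mat_cong) (simp add: D_simps skew_distrib_right coord_add)
  show "rep (d \<otimes>\<^bsub>skewD\<^esub> e) = rep d \<otimes>\<^bsub>matrix_ring Kx_ring 4\<^esub> rep e"
    unfolding rep_def mat_mult
  proof (rule mat_cong)
    fix i j :: nat assume i: "i < 4"
    have "d \<otimes>\<^bsub>skewD\<^esub> e \<star> ym j = d \<star> (\<Sum>k<4. ym k \<star> lift (coord k (e \<star> ym j)))"
      by (simp add: sum_ym_coord D_simps skew_assoc)
    also have "\<dots> = (\<Sum>k<4. d \<star> ym k \<star> lift (coord k (e \<star> ym j)))"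
      by (simp add: skew_sum skew_assoc)
    finally show "coord i (d \<otimes>\<^bsub>skewD\<^esub> e \<star> ym j) = (\<Sum>k<4. coord i (d \<star> ym k) * coord k (e \<star> ym j))"
      by (simp add: coord_sum coord_mult_lift i)
  qed
next
  show "rep \<one>\<^bsub>skewD\<^esub> = \<one>\<^bsub>matrix_ring Kx_ring 4\<^esub>"
    unfolding rep_def mat_one by (rule mat_cong) (simp add: D_simps coord_ym)
qed (simp add: rep_def mat_carrier)

lemma rep_center:
  assumes "z \<in> ring_center skewD"
  shows "rep z = scalar_matrix Kx_ring 4 z"
proof -
  obtain c where c: "z = lift c" using assms center_subset_Kx by blast
  have "z \<star> d = d \<star> z" for d using assms by (simp add: ring_center_def D_simps)
  then show ?thesis
    unfolding rep_def c mat_scalar by (intro mat_cong) (simp add: coord_mult_lift coord_ym)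
qed

lemma co_0_y_power:
  assumes "e < 8"
  shows "co 0 (y ^ e) = (if e = 0 then 1 else if e = 4 then K_s else 0)"
proof (cases "e < 4")
  case True
  then show ?thesis by (simp add: co_y_power)
next
  case False
  then obtain e' where e: "e = 4 + e'" "e' < 4"
    using assms by (metis add_less_cancel_left le_add_diff_inverse not_less numeral_Bit0)
  then have "y ^ e = emb K_s * y ^ e'" by (simp add: power_add y4)
  then show ?thesis using e by (simp add: co_linear co_y_power)
qed

text \<open>
  The sum on the left is the trace of \<open>v\<close> from \<open>F\<close> to \<open>K\<close>.
\<close>
lemma sum_pw: "(\<Sum>k<4. pw (int k) v) = emb (4 * co 0 v)"
proof -
  obtain a0 a1 a2 a3 where v: "v = qd a0 a1 a2 a3" using qd_surj by metis
  have "pw 0 v = qd a0 a1 a2 a3" "pw 1 v = qd a0 (K_iota * a1) (- a2) (- K_iota * a3)"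
    "pw 2 v = qd a0 (- a1) a2 (- a3)" "pw 3 v = qd a0 (- K_iota * a1) (- a2) (K_iota * a3)"
  proof -
    have "pw 3 v = \<sigma> (pw 2 v)" using int_funpow_Suc[OF bij, of 2 v] by simp
    then show "pw 3 v = qd a0 (- K_iota * a1) (- a2) (K_iota * a3)"
      unfolding v pw_2_qd \<sigma>_qd by simp
  qed (simp_all add: v pw_2_qd \<sigma>_qd int_funpow_1)
  moreover have "(\<Sum>k<4. pw (int k) v) = pw 0 v + pw 1 v + pw 2 v + pw 3 v"
    by (simp add: eval_nat_numeral)
  ultimately have "(\<Sum>k<4. pw (int k) v) = qd (4 * a0) 0 0 0"
    by (simp add: qd_add)
  also have "\<dots> = emb (4 * co 0 v)" by (simp only: v co_qd_simps) (simp add: qd_def)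
  finally show ?thesis .
qed

lemma coord_skew_monom: "i < 4 \<Longrightarrow> coord i (skew_monom u m) = fls_shift (- m) (fls_const (co i u))"
  by (rule fls_eqI) (auto simp: nth_coord fls_nth_skew_monom co_zero)

text \<open>
  The matrix unit at \<open>(i, j)\<close> is \<open>\<Sum>\<^sub>k (4 s)\<^bsup>-1\<^esup> x\<^bsup>-k\<^esup> rep(y\<^sup>i x\<^sup>k y\<^bsup>4-j\<^esup>)\<close> with \<open>k\<close> ranging over \<open>0, \<dots>,
  3\<close>: since \<open>x\<^sup>k\<close> acts on \<open>y\<^bsup>4-j+l\<^esup>\<close> through \<open>\<sigma>\<^sup>k\<close>, the sum over \<open>k\<close> is a trace from \<open>F\<close> to \<open>K\<close>,
  which picks out \<open>l = j\<close>. A general matrix is the combination of these 64 products indexed by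
  \<open>(i, j, k)\<close>.
\<close>
lemma rep_spans:
  "\<exists>k. \<exists>d \<in> {..<k::nat} \<rightarrow> carrier skewD. \<exists>c \<in> {..<k} \<rightarrow> Kx.
     mat E = (\<Oplus>\<^bsub>matrix_ring Kx_ring 4\<^esub>i \<in> {..<k}. scalar_matrix Kx_ring 4 (c i) \<otimes>\<^bsub>matrix_ring Kx_ring 4\<^esub> rep (d i))"
proof -
  let ?T = "{..<4 :: nat} \<times> {..<4 :: nat} \<times> {..<4 :: nat}"
  define d where "d = (\<lambda>(i, j, k). skew_monom (y ^ i * pw (int k) (y ^ (4 - j))) (int k))"
  define c where "c = (\<lambda>(i, j, k). E i j * fls_shift (int k) (fls_const (inverse (4 * K_s))))"
  define G where "G = (\<lambda>t a l. c t * coord a (d t \<star> ym l))"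
  have term_mat: "scalar_matrix Kx_ring 4 (lift (c t)) \<otimes>\<^bsub>matrix_ring Kx_ring 4\<^esub> rep (d t) = mat (G t)" for t
    unfolding mat_scalar rep_def mat_mult
    by (rule mat_cong) (simp add: G_def if_distrib[of "\<lambda>a. a * _"] cong: if_cong)
  have K4: "4 * K_s \<noteq> 0"
  proof -
    have "(4 :: K_field) = 2 * 2" by simp
    then show ?thesis using K_two_neq_0 K_s_neq_0 by (metis mult_eq_0_iff)
  qed
  have entry: "(\<Sum>t\<in>?T. G t a l) = E a l" if al: "a < 4" "l < 4" for a l
  proof -
    have G: "G (i, j, k) a l = E i j * fls_const (inverse (4 * K_s) * co a (y ^ i * pw (int k) (y ^ (4 - j + l))))" for i j k
    proof -
      have "d (i, j, k) \<star> ym l = skew_monom (y ^ i * pw (int k) (y ^ (4 - j + l))) (int k)"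
        by (simp add: d_def skew_mult_monom[OF bij zero] pw_mult power_add mult_ac)
      then show ?thesis
        by (simp add: G_def c_def coord_skew_monom al fls_shifted_times_simps)
    qed
    have "(\<Sum>k<4. G (i, j, k) a l) = (if i = a \<and> j = l then E a l else 0)" if ij: "i < 4" "j < 4" for i j
    proof -
      have "(\<Sum>k<4. co a (y ^ i * pw (int k) v)) = co a (y ^ i * emb (4 * co 0 v))" for v
        unfolding sum_pw[symmetric] by (simp add: sum_distrib_left co_sum al)
      also have "co a (y ^ i * emb b) = (if i = a then b else 0)" for b
        using co_linear(2)[of a b "y ^ i"] al ij by (simp add: mult.commute co_y_power)
      finally have "(\<Sum>k<4. co a (y ^ i * pw (int k) (y ^ (4 - j + l)))) =
          (if i = a then 4 * co 0 (y ^ (4 - j + l)) else 0)" .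
      also have "co 0 (y ^ (4 - j + l)) = (if j = l then K_s else 0)"
        using ij al by (subst co_0_y_power) auto
      finally have "(\<Sum>k<4. co a (y ^ i * pw (int k) (y ^ (4 - j + l)))) =
          (if i = a \<and> j = l then 4 * K_s else 0)" by simp
      note co_sum_value = this
      have const_sum: "(\<Sum>k<4. fls_const (f k)) = fls_const (\<Sum>k<(4::nat). f k)" for f :: "nat \<Rightarrow> K_field"
        by (rule fls_eqI) (simp add: fls_nth_sum)
      have "(\<Sum>k<4. G (i, j, k) a l) =
          E i j * fls_const (inverse (4 * K_s) * (\<Sum>k<4. co a (y ^ i * pw (int k) (y ^ (4 - j + l)))))"
        by (simp only: G const_sum sum_distrib_left[symmetric])
      also have "\<dots> = (if i = a \<and> j = l then E a l else 0)"
        using K4 unfolding co_sum_value by auto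
      finally show ?thesis .
    qed
    moreover have "(\<Sum>t\<in>?T. G t a l) = (\<Sum>i<4. \<Sum>j<4. \<Sum>k<4. G (i, j, k) a l)"
      by (simp add: sum.cartesian_product case_prod_unfold)
    ultimately have "(\<Sum>t\<in>?T. G t a l) = (\<Sum>i<4. \<Sum>j<4. if i = a \<and> j = l then E a l else 0)"
      by simp
    also have "\<dots> = (\<Sum>i<4. if i = a then E a l else 0)"
      by (rule sum.cong) (use al in auto)
    finally show ?thesis using al by simp
  qed
  obtain h where h: "bij_betw h {..<card ?T} ?T"
    using ex_bij_betw_nat_finite[of ?T] by (auto simp: lessThan_atLeast0)
  have "(\<Oplus>\<^bsub>matrix_ring Kx_ring 4\<^esub>i \<in> {..<card ?T}. scalar_matrix Kx_ring 4 (lift (c (h i))) \<otimes>\<^bsub>matrix_ring Kx_ring 4\<^esub> rep (d (h i)))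
      = mat (\<lambda>a l. \<Sum>i<card ?T. G (h i) a l)"
    by (simp add: term_mat finsum_mat)
  also have "\<dots> = mat E"
    by (rule mat_cong) (simp only: sum.reindex_bij_betw[OF h, of "\<lambda>t. G t _ _"] entry)
  finally have sum_eq: "(\<Oplus>\<^bsub>matrix_ring Kx_ring 4\<^esub>i \<in> {..<card ?T}.
      scalar_matrix Kx_ring 4 (lift (c (h i))) \<otimes>\<^bsub>matrix_ring Kx_ring 4\<^esub> rep (d (h i))) = mat E" .
  show ?thesis
  proof (rule exI[of _ "card ?T"], rule bexI[of _ "d \<circ> h"], rule bexI[of _ "lift \<circ> c \<circ> h"])
    show "mat E = (\<Oplus>\<^bsub>matrix_ring Kx_ring 4\<^esub>i \<in> {..<card ?T}.
        scalar_matrix Kx_ring 4 ((lift \<circ> c \<circ> h) i) \<otimes>\<^bsub>matrix_ring Kx_ring 4\<^esub> rep ((d \<circ> h) i))"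
      using sum_eq by (simp only: comp_def)
  qed (auto simp: D_simps)
qed

lemma splitting_rep: "splitting skewD Kx 4 rep"
  unfolding splitting_def Let_def
  using subfield_Kx center_subset_Kx rep_hom rep_center rep_spans by (auto elim!: mat_surj)

end

section \<open>Trace zero without being a commutator\<close>

context quartic_extension
begin

lemma skew_monom_add: "skew_monom a m + skew_monom b m = skew_monom (a + b) m" for a b :: 'f
  by (rule fls_eqI) (simp add: fls_nth_skew_monom)

lemma skew_monom_mult: "skew_monom a i \<star> skew_monom b j = skew_monom (a * pw i b) (i + j)"
  by (rule skew_mult_monom[OF bij zero])

text \<open>
  \<open>y\<close> anticommutes with \<open>x\<^bsup>-2\<^esup>\<close>, so \<open>(1 + y\<^sup>2) x\<^bsup>-2\<^esup>\<close> is the commutator of \<open>y\<close> and \<open>(1 + y\<^sup>2) (2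
  y)\<^bsup>-1\<^esup> x\<^bsup>-2\<^esup>\<close>; and \<open>\<sigma>\<close> negates \<open>y\<^sup>2\<close>, so \<open>2 v\<close> is the commutator of \<open>x\<close> and \<open>- v x\<^bsup>-1\<^esup>\<close> for \<open>v \<in> K
  y\<^sup>2\<close>.
\<close>
lemma reduced_trace_witness: "reduced_trace skewD witness = \<zero>\<^bsub>skewD\<^esub>"
proof -
  interpret SR: ring skewD by (rule ring_skew_laurent)
  let ?u = "(1 + y ^ 2) / (2 * y)"
  let ?c = "skew_monom (1 + y ^ 2) (- 2)"
  have "pw (- 2) y = - y"
    using pw_mod_4[of "- 2" 2 y] pw_2_qd[of 0 1 0 0] by (simp add: qd_def emb_minus)
  then have "?c + skew_monom ?u (- 2) \<star> skew_monom y 0 = skew_monom y 0 \<star> skew_monom ?u (- 2)"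
    using y_neq_0 two_neq_0 by (simp add: skew_monom_mult skew_monom_add field_simps)
  moreover
  define v where "v = qd 0 0 (K_const (1 / 2) * (K_const (1 / 2) * K_r)) 0"
  let ?w = "emb K_r / 2 * y ^ 2"
  have "K_const (1 / 2) + K_const (1 / 2) = 1" using K_half by (simp only: mult_2_right)
  then have "K_const (1 / 2) * d + K_const (1 / 2) * d = d" for d
    by (metis distrib_right mult_1)
  then have v: "v + v = ?w" unfolding v_def r_half_y2 qd_add by (simp only: add_0)
  have "\<sigma> v = - v" by (simp add: v_def \<sigma>_qd qd_minus)
  then have "skew_monom ?w 0 + skew_monom (- v) (- 1) \<star> skew_monom 1 1 =
      skew_monom 1 1 \<star> skew_monom (- v) (- 1)"
    unfolding v[symmetric] by (simp add: skew_monom_mult skew_monom_add int_funpow_1 minus)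
  ultimately have trace: "matrix_trace (skewD\<lparr>carrier := L'\<rparr>) n (\<phi> witness) = \<zero>\<^bsub>skewD\<^esub>" if "splitting skewD L' n \<phi>" for L' n \<phi>
    using SR.splitting_trace_sum_of_commutators[OF that,
        of "skew_monom y 0" "skew_monom ?u (- 2)" "skew_monom 1 1" "skew_monom (- v) (- 1)" ?c "skew_monom ?w 0"]
    by (simp add: D_simps witness_def)
  show ?thesis
    unfolding reduced_trace_def
    by (rule the_equality) (use trace splitting_rep in \<open>metis\<close>)+
qed

end

theorem theorem6p1:
  fixes emb :: "K_field \<Rightarrow> 'f :: field"
    and y :: 'f
    and \<sigma> :: "'f \<Rightarrow> 'f"
    and A :: "'f fls"
  defines "D \<equiv> skew_laurent \<sigma>"
  assumes emb: "emb \<in> ring_hom ring_of_type_algebra ring_of_type_algebra"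
    and y4: "y ^ 4 = emb K_s"
    and F: "generate_field ring_of_type_algebra (insert y (range emb)) = UNIV"
    and \<sigma>_aut: "\<sigma> \<in> ring_iso ring_of_type_algebra ring_of_type_algebra"
    and \<sigma>_K: "\<And>c. \<sigma> (emb c) = emb c"
    and \<sigma>_y: "\<sigma> y = emb K_iota * y"
    and A: "A = skew_monom (1 + y ^ 2) (- 2) \<oplus>\<^bsub>D\<^esub> skew_monom (emb K_r / 2 * y ^ 2) 0"
  shows "reduced_trace D A = \<zero>\<^bsub>D\<^esub> \<and>
    \<not> (\<exists>B \<in> carrier D. \<exists>C \<in> carrier D. A = B \<otimes>\<^bsub>D\<^esub> C \<ominus>\<^bsub>D\<^esub> C \<otimes>\<^bsub>D\<^esub> B)"
proof -
  interpret quartic_extension \<sigma> emb y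
  proof
    show "emb (a + b) = emb a + emb b" "emb (a * b) = emb a * emb b" "emb 1 = 1" for a b
      using ring_hom_add[OF emb, of a b] ring_hom_mult[OF emb, of a b] ring_hom_one[OF emb]
      by (simp_all add: ring_of_type_algebra_def)
    show "\<sigma> (a + b) = \<sigma> a + \<sigma> b" "\<sigma> (a * b) = \<sigma> a * \<sigma> b" "bij \<sigma>" for a b
      using ring_iso_memE(2,3,5)[OF \<sigma>_aut] by (simp_all add: ring_of_type_algebra_def)
  qed (fact y4 F \<sigma>_K \<sigma>_y)+
  have A_witness: "A = witness"
    unfolding A D_def witness_def by (simp add: D_simps)
  have "\<not> (\<exists>B C. witness = B \<star> C - C \<star> B)"
    using commutator_impossible by blast
  then have "\<not> (\<exists>B\<in>carrier D. \<exists>C\<in>carrier D. A = B \<otimes>\<^bsub>D\<^esub> C \<ominus>\<^bsub>D\<^esub> C \<otimes>\<^bsub>D\<^esub> B)"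
    unfolding A_witness D_def skew_laurent_minus by (simp add: D_simps)
  then show ?thesis using reduced_trace_witness by (simp add: A_witness D_def)
qed

end
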